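(* Let $\tau_1$ and $\tau_2$ be adjacent $\Phi$-topes, let $H$ be the wall spanned by $\overline{\tau_1}\cap\overline{\tau_2}$, and let $A$ be the set of $i\in\{1,\dots,N\}$ such that $\phi_i$ belongs to the open side of $H$ which contains $\tau_1$. If $\lambda\in\tau_2$, then $$\mathcal X(\Phi,\tau_1)\,[V(\Phi,\lambda)]=[\mathfrak p(\Phi,\lambda)]-(-1)^{|A|}\,[\mathfrak p_{\rm flip}(\Phi,A,\lambda)].$$
   Context: $F$ is a real vector space of dimension $r$; $\Phi=(\phi_1,\dots,\phi_N)$ is a sequence of nonzero elements of $F$ which generates $F$ and such that the cone $\mathfrak c(\Phi)=\{\sum_i t_i\phi_i: t_i\ge 0\}$ is salient (contains no affine line). For $\lambda\in F$: $V(\Phi,\lambda)=\{x\in\mathbb R^N:\sum_i x_i\phi_i=\lambda\}$, $\mathfrak p(\Phi,\lambda)=\{x\in V(\Phi,\lambda): x_i\ge 0 \text{ for all } i\}$, and for $A\subseteq\{1,\dots,N\}$, $\mathfrak p_{\rm flip}(\Phi,A,\lambda)=\{x\in V(\Phi,\lambda): x_i<0 \text{ if } i\in A,\ x_i\ge 0 \text{ if } i\notin A\}$. $[E]$ denotes the characteristic function of a set $E\subseteq\mathbb R^N$. A $\Phi$-wall is a hyperplane of $F$ spanned by $r-1$ linearly independent elements of $\Phi$; a $\Phi$-tope is a connected component of the complement in $F$ of the union of all $\Phi$-walls. Two topes are adjacent if the intersection of their closures is contained in a wall and spans this wall. For a tope $\tau$, $\mathcal G(\Phi,\tau)$ is the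 set of $I\subseteq\{1,\dots,N\}$ such that $\{\phi_i,i\in I\}$ generates $F$ and $\tau$ is contained in the cone generated by $\{\phi_i,i\in I\}$. With $I^c$ the complement of $I$ in $\{1,\dots,N\}$, the Geometric Brianchon-Gram function on $\mathbb R^N$ is $$\mathcal X(\Phi,\tau)=\sum_{I\in\mathcal G(\Phi,\tau)}(-1)^{|I|-\dim F}\prod_{j\in I^c}[x_j\ge 0].$$ *)

theory Defs
  imports "HOL-Analysis.Analysis"
begin

definition cone_of :: "('n::finite \<Rightarrow> 'a::euclidean_space) \<Rightarrow> 'n set \<Rightarrow> 'a set" where
  "cone_of \<phi> I = {\<Sum>i\<in>I. t i *\<^sub>R \<phi> i | t. \<forall>i\<in>I. 0 \<le> t i}"

definition salient :: "'a::real_vector set \<Rightarrow> bool" where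
  "salient C \<longleftrightarrow> \<not> (\<exists>x d. d \<noteq> 0 \<and> range (\<lambda>t::real. x + t *\<^sub>R d) \<subseteq> C)"

definition affine_fibre :: "('n::finite \<Rightarrow> 'a::euclidean_space) \<Rightarrow> 'a \<Rightarrow> (real ^ 'n) set" where
  "affine_fibre \<phi> l = {x. (\<Sum>i\<in>UNIV. x $ i *\<^sub>R \<phi> i) = l}"

definition partition_polytope :: "('n::finite \<Rightarrow> 'a::euclidean_space) \<Rightarrow> 'a \<Rightarrow> (real ^ 'n) set" where
  "partition_polytope \<phi> l = {x \<in> affine_fibre \<phi> l. \<forall>i. 0 \<le> x $ i}"

definition flipped_polytope ::
    "('n::finite \<Rightarrow> 'a::euclidean_space) \<Rightarrow> 'n set \<Rightarrow> 'a \<Rightarrow> (real ^ 'n) set" where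
  "flipped_polytope \<phi> A l =
     {x \<in> affine_fibre \<phi> l. (\<forall>i\<in>A. x $ i < 0) \<and> (\<forall>i\<in>-A. 0 \<le> x $ i)}"

definition walls :: "('n::finite \<Rightarrow> 'a::euclidean_space) \<Rightarrow> 'a set set" where
  "walls \<phi> = {span B | B. B \<subseteq> range \<phi> \<and> independent B \<and> card B = DIM('a) - 1}"

definition topes :: "('n::finite \<Rightarrow> 'a::euclidean_space) \<Rightarrow> 'a set set" where
  "topes \<phi> = components (- \<Union>(walls \<phi>))"

definition adjacent_topes ::
    "('n::finite \<Rightarrow> 'a::euclidean_space) \<Rightarrow> 'a set \<Rightarrow> 'a set \<Rightarrow> bool" where
  "adjacent_topes \<phi> \<tau>\<^sub>1 \<tau>\<^sub>2 \<longleftrightarrow>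
     \<tau>\<^sub>1 \<in> topes \<phi> \<and> \<tau>\<^sub>2 \<in> topes \<phi> \<and>
     (\<exists>H\<in>walls \<phi>. closure \<tau>\<^sub>1 \<inter> closure \<tau>\<^sub>2 \<subseteq> H \<and> span (closure \<tau>\<^sub>1 \<inter> closure \<tau>\<^sub>2) = H)"

text \<open>The two open half-spaces bounded by a hyperplane through the origin. They do not depend
  on the inner product, since every linear functional has the form \<open>\<lambda>x. a \<bullet> x\<close>.\<close>

definition open_sides :: "'a::euclidean_space set \<Rightarrow> 'a set set" where
  "open_sides H = {{x. a \<bullet> x > 0} | a. a \<noteq> 0 \<and> H = {x. a \<bullet> x = 0}}"

definition generating_sets ::
    "('n::finite \<Rightarrow> 'a::euclidean_space) \<Rightarrow> 'a set \<Rightarrow> 'n set set" where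
  "generating_sets \<phi> \<tau> = {I. span (\<phi> ` I) = UNIV \<and> \<tau> \<subseteq> cone_of \<phi> I}"

text \<open>The natural-number subtraction in the exponent does not truncate: if the \<open>\<phi> i\<close> with
  \<open>i \<in> I\<close> generate the space, then \<open>card I \<ge> DIM('a)\<close>.\<close>

definition brianchon_gram ::
    "('n::finite \<Rightarrow> 'a::euclidean_space) \<Rightarrow> 'a set \<Rightarrow> real ^ 'n \<Rightarrow> real" where
  "brianchon_gram \<phi> \<tau> x =
     (\<Sum>I\<in>generating_sets \<phi> \<tau>.
        (- 1) ^ (card I - DIM('a)) * (\<Prod>j\<in>-I. indicator {y. 0 \<le> y $ j} x))"

end

theory Submission
  imports Defs
begin

text \<open>
  Fix \<open>x\<close> with \<open>\<Sum>i. x i \<phi> i = \<lambda>\<close> and let \<open>N\<close> be the set of \<open>i\<close> with \<open>x i < 0\<close>. The product of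
  indicators attached to \<open>I\<close> is \<open>1\<close> exactly when \<open>N \<subseteq> I\<close>, so up to the sign \<open>(-1)\<^sup>r\<close> the
  Brianchon-Gram function at \<open>x\<close> is the alternating sum \<open>S \<tau> N\<close> of \<open>(-1) ^ card I\<close> over the
  \<open>I \<in> generating_sets \<tau>\<close> containing \<open>N\<close>. The theorem computes \<open>S \<tau>\<^sub>1 N\<close> for \<open>\<lambda> \<in> \<tau>\<^sub>2\<close>.

  For \<open>\<lambda> \<in> \<tau>\<close> one has \<open>S \<tau> N = (-1)\<^sup>r\<close> if \<open>N\<close> is empty and \<open>0\<close> otherwise (\<open>brianchon_gram_sum\<close>). To
  see this, choose a generic cost \<open>c\<close>. For each \<open>I \<in> generating_sets \<tau>\<close> the linear program that minimises \<open>c\<close>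
  over the face of the polytope supported on \<open>I\<close> has exactly one optimal basis \<open>b\<close>, and the sets
  \<open>I\<close> with optimal basis \<open>b\<close> form the interval between \<open>b\<close> and \<open>b \<union> U b\<close>, where \<open>U b\<close> is the set of
  indices with positive reduced cost. An alternating sum over an interval of sets vanishes
  unless the interval is a single set. For empty \<open>N\<close> this leaves the unique vertex that maximises
  \<open>c\<close>; for nonempty \<open>N\<close> it leaves nothing, provided that \<open>c\<close> is larger at \<open>x\<close> than on the polytope.

  Let \<open>a\<close> be a normal of the wall with \<open>\<tau>\<^sub>1\<close> on its positive side, and let \<open>A\<close>, \<open>B\<close>, \<open>C\<close> be the indices of
  the vectors on the positive side, on the wall and on the negative side. Near a point \<open>\<mu>\<close> of the
  common face that lies on no other wall, \<open>\<tau>\<^sub>1\<close> and \<open>\<tau>\<^sub>2\<close> are the two half balls. If \<open>\<mu>\<close> is in the cone of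
  \<open>I \<inter> B\<close>, then \<open>I \<in> generating_sets \<tau>\<^sub>1\<close> means that \<open>I\<close> meets \<open>A\<close>, and \<open>I \<in> generating_sets \<tau>\<^sub>2\<close> that \<open>I\<close> meets \<open>C\<close>; for all other \<open>I\<close>
  the two conditions agree (\<open>generating_sets_at_wall\<close>). Splitting \<open>I\<close> into \<open>I \<inter> B\<close> and \<open>I - B\<close> gives
  \<open>S \<tau>\<^sub>1 N - S \<tau>\<^sub>2 N = W (N \<inter> B) * ((-1) ^ card A [N - B = A] - (-1) ^ card C [N - B = C])\<close>
  with a factor \<open>W\<close> (\<open>wall_sum\<close>) that depends only on the vectors on the wall (\<open>alternating_sum_wall_crossing\<close>).
  For \<open>\<lambda> \<in> \<tau>\<^sub>2\<close> the case \<open>N - B = C\<close> is impossible by signs.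

  It remains to find \<open>W (N \<inter> B)\<close> when \<open>N - B = A\<close>. For this, replace \<open>\<phi> i\<close> and \<open>x i\<close> by their
  negatives for \<open>i \<in> A\<close>. The walls, the topes and \<open>W\<close> do not change, the point still lies over
  \<open>\<lambda>\<close>, its negative set is now \<open>N \<inter> B\<close>, and \<open>\<tau>\<^sub>1\<close> has left the cone because all vectors are in the closed
  half-space containing \<open>\<tau>\<^sub>2\<close>. The new cone is again salient (\<open>flip_positive_functional\<close>). The same crossing formula with \<open>S \<tau>\<^sub>1 = 0\<close> on its left side then shows that \<open>W (N \<inter> B)\<close> is
  \<open>- (-1)\<^sup>r\<close> if \<open>N \<inter> B\<close> is empty and \<open>0\<close> otherwise (\<open>wall_sum_flipped_point\<close>). So the correction term is present exactly
  for \<open>N = A\<close>, that is, on the flipped polytope.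
\<close>

section \<open>Alternating sums over intervals of sets\<close>

text \<open>Toggling an element of \<open>M - L\<close> pairs the sets of the interval with opposite signs.\<close>

lemma sum_alternating_interval:
  fixes L M :: "'i set"
  assumes "finite M"
  shows "(\<Sum>I | L \<subseteq> I \<and> I \<subseteq> M. (- 1) ^ card I :: real) = (if L = M then (- 1) ^ card M else 0)"
proof (cases "L \<subset> M")
  case False
  then have "{I. L \<subseteq> I \<and> I \<subseteq> M} = (if L = M then {M} else {})" by auto
  then show ?thesis by simp
next
  case True
  then obtain e where e: "e \<in> M" "e \<notin> L" by blast
  let ?D = "{I. L \<subseteq> I \<and> I \<subseteq> M - {e}}"
  have fin: "finite I" if "I \<subseteq> M - {e}" for I
    using that assms finite_subset by blast
  have "finite ?D"
    by (rule finite_subset[of _ "Pow M"]) (use assms in auto)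
  have split: "{I. L \<subseteq> I \<and> I \<subseteq> M} = ?D \<union> insert e ` ?D"
  proof (intro equalityI subsetI)
    fix I assume "I \<in> {I. L \<subseteq> I \<and> I \<subseteq> M}"
    then show "I \<in> ?D \<union> insert e ` ?D"
      using e by (cases "e \<in> I") (auto intro!: image_eqI[of I "insert e" "I - {e}"])
  qed (use e in auto)
  have "inj_on (insert e) ?D"
    by (rule inj_onI) (auto dest: insert_ident[THEN iffD1, rotated 2])
  then have "(\<Sum>I\<in>insert e ` ?D. (- 1) ^ card I :: real) = (\<Sum>I\<in>?D. (- 1) ^ card (insert e I))"
    by (simp add: sum.reindex)
  also have "\<dots> = - (\<Sum>I\<in>?D. (- 1) ^ card I)"
    unfolding sum_negf[symmetric]
    by (rule sum.cong) (use fin in \<open>auto simp: card_insert_if\<close>)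
  finally show ?thesis
    unfolding split using \<open>finite ?D\<close> True
    by (subst sum.union_disjoint) auto
qed

text \<open>The sets \<open>L\<close> are the possible parts off the wall of an index set. Since \<open>L \<subseteq> A \<union> C\<close>, meeting \<open>A\<close> means not
  being contained in \<open>C\<close>, which turns both terms into alternating sums over intervals.\<close>

lemma alternating_sum_one_sided:
  fixes A B C M :: "'i::finite set"
  assumes disj: "A \<inter> B = {}" "B \<inter> C = {}" "A \<inter> C = {}" and un: "A \<union> B \<union> C = UNIV"
  shows "(\<Sum>L | M \<subseteq> L \<and> L \<subseteq> - B.
        (- 1) ^ card L * (of_bool (\<exists>i\<in>L. i \<in> A) - of_bool (\<exists>i\<in>L. i \<in> C)) :: real) =
    (if M = A then (- 1) ^ card A else 0) - (if M = C then (- 1) ^ card C else 0)"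
proof -
  have restrict: "(\<Sum>L | M \<subseteq> L \<and> L \<subseteq> - B. (- 1) ^ card L * of_bool (L \<subseteq> E) :: real) =
      (if M = E then (- 1) ^ card E else 0)" if "E \<subseteq> - B" for E
  proof -
    have "(\<Sum>L | M \<subseteq> L \<and> L \<subseteq> - B. (- 1) ^ card L * of_bool (L \<subseteq> E) :: real) =
        (\<Sum>L | M \<subseteq> L \<and> L \<subseteq> E. (- 1) ^ card L)"
      by (rule sum.mono_neutral_cong_right) (use that in auto)
    then show ?thesis using sum_alternating_interval[of E M] by simp
  qed
  have "(\<Sum>L | M \<subseteq> L \<and> L \<subseteq> - B.
        (- 1) ^ card L * (of_bool (\<exists>i\<in>L. i \<in> A) - of_bool (\<exists>i\<in>L. i \<in> C)) :: real) =
      (\<Sum>L | M \<subseteq> L \<and> L \<subseteq> - B. (- 1) ^ card L * of_bool (L \<subseteq> A) - (- 1) ^ card L * of_bool (L \<subseteq> C))"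
  proof (rule sum.cong)
    fix L assume "L \<in> {L. M \<subseteq> L \<and> L \<subseteq> - B}"
    then have "(\<exists>i\<in>L. i \<in> A) \<longleftrightarrow> \<not> L \<subseteq> C" "(\<exists>i\<in>L. i \<in> C) \<longleftrightarrow> \<not> L \<subseteq> A" using disj un by blast+
    then show "(- 1) ^ card L * (of_bool (\<exists>i\<in>L. i \<in> A) - of_bool (\<exists>i\<in>L. i \<in> C)) =
        (- 1) ^ card L * of_bool (L \<subseteq> A) - (- 1 :: real) ^ card L * of_bool (L \<subseteq> C)"
      by (simp add: right_diff_distrib of_bool_not_iff)
  qed simp
  also have "\<dots> = (if M = A then (- 1) ^ card A else 0) - (if M = C then (- 1) ^ card C else 0)"
  proof -
    have "A \<subseteq> - B" "C \<subseteq> - B" using disj by blast+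
    then show ?thesis unfolding sum_subtractf by (simp only: restrict)
  qed
  finally show ?thesis .
qed

lemma sum_superset_split:
  fixes B N :: "'i::finite set" and f g :: "'i set \<Rightarrow> real"
  shows "(\<Sum>I | N \<subseteq> I. f (I \<inter> B) * g (I - B)) =
    (\<Sum>K | N \<inter> B \<subseteq> K \<and> K \<subseteq> B. f K) * (\<Sum>L | N - B \<subseteq> L \<and> L \<subseteq> - B. g L)"
proof -
  have "(\<Sum>I | N \<subseteq> I. f (I \<inter> B) * g (I - B)) =
      (\<Sum>(K, L)\<in>{K. N \<inter> B \<subseteq> K \<and> K \<subseteq> B} \<times> {L. N - B \<subseteq> L \<and> L \<subseteq> - B}. f K * g L)"
    by (rule sum.reindex_bij_witness[of _ "\<lambda>(K, L). K \<union> L" "\<lambda>I. (I \<inter> B, I - B)"])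
      (auto simp: Int_Un_distrib2 Un_Diff intro!: arg_cong2[of _ _ _ _ "\<lambda>K L. f K * g L"])
  then show ?thesis by (simp add: sum_product sum.cartesian_product)
qed

section \<open>Cones, walls and topes\<close>

definition combination :: "('n::finite \<Rightarrow> 'a::euclidean_space) \<Rightarrow> real ^ 'n \<Rightarrow> 'a" where
  "combination \<phi> x = (\<Sum>i\<in>UNIV. x $ i *\<^sub>R \<phi> i)"

lemma linear_combination: "linear (combination \<phi>)"
  by (rule linearI)
    (simp_all add: combination_def scaleR_left_distrib sum.distrib scaleR_sum_right)

lemmas combination_simps =
  linear_add[OF linear_combination] linear_diff[OF linear_combination]
  linear_scale[OF linear_combination] linear_neg[OF linear_combination]
  linear_0[OF linear_combination]

lemma axis_component: "axis j t $ i = (if i = j then t else 0)"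
  by (simp add: axis_def)

lemma combination_axis [simp]: "combination \<phi> (axis i t) = t *\<^sub>R \<phi> i"
  by (simp add: combination_def axis_def if_distrib[of "\<lambda>u. u *\<^sub>R _"] sum.delta cong: if_cong)

lemma inner_combination: "y \<bullet> combination \<phi> x = (\<Sum>i\<in>UNIV. x $ i * (y \<bullet> \<phi> i))"
  by (simp add: combination_def inner_sum_right)

lemma affine_fibre_iff: "x \<in> affine_fibre \<phi> l \<longleftrightarrow> combination \<phi> x = l"
  by (simp add: affine_fibre_def combination_def)

lemma span_image_combination:
  "span (\<phi> ` J) = {combination \<phi> z | z. \<forall>i. i \<notin> J \<longrightarrow> z $ i = 0}" (is "_ = ?R")
proof
  have "subspace ?R"
    unfolding subspace_def
  proof (intro conjI ballI allI)
    show "0 \<in> ?R" by (auto intro!: exI[of _ 0] simp: combination_simps)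
  next
    fix x y assume "x \<in> ?R" "y \<in> ?R"
    then obtain u v where "x = combination \<phi> u" "\<forall>i. i \<notin> J \<longrightarrow> u $ i = 0"
      "y = combination \<phi> v" "\<forall>i. i \<notin> J \<longrightarrow> v $ i = 0" by blast
    then show "x + y \<in> ?R" by (auto intro!: exI[of _ "u + v"] simp: combination_simps)
  next
    fix c x assume "x \<in> ?R"
    then obtain u where "x = combination \<phi> u" "\<forall>i. i \<notin> J \<longrightarrow> u $ i = 0" by blast
    then show "c *\<^sub>R x \<in> ?R" by (auto intro!: exI[of _ "c *\<^sub>R u"] simp: combination_simps)
  qed
  moreover have "\<phi> ` J \<subseteq> ?R"
  proof
    fix y assume "y \<in> \<phi> ` J"
    then obtain j where "j \<in> J" "y = \<phi> j" by blast
    then show "y \<in> ?R" by (auto intro!: exI[of _ "axis j 1"] simp: axis_component)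
  qed
  ultimately show "span (\<phi> ` J) \<subseteq> ?R" by (rule span_minimal[rotated])
next
  show "?R \<subseteq> span (\<phi> ` J)"
  proof
    fix y assume "y \<in> ?R"
    then obtain z where z: "y = combination \<phi> z" "\<forall>i. i \<notin> J \<longrightarrow> z $ i = 0" by blast
    have "z $ i *\<^sub>R \<phi> i \<in> span (\<phi> ` J)" for i
      using z(2) by (cases "i \<in> J") (auto intro: span_scale span_base simp: span_zero)
    then show "y \<in> span (\<phi> ` J)"
      unfolding z(1) combination_def by (intro span_sum)
  qed
qed

lemma cone_of_iff:
  "y \<in> cone_of \<phi> I \<longleftrightarrow>
     (\<exists>x. combination \<phi> x = y \<and> (\<forall>i. 0 \<le> x $ i) \<and> (\<forall>i. i \<notin> I \<longrightarrow> x $ i = 0))"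
proof
  assume "y \<in> cone_of \<phi> I"
  then obtain t where t: "y = (\<Sum>i\<in>I. t i *\<^sub>R \<phi> i)" "\<forall>i\<in>I. 0 \<le> t i"
    unfolding cone_of_def by blast
  have "combination \<phi> (\<chi> i. if i \<in> I then t i else 0) = y"
    by (simp add: combination_def t(1) if_distrib[of "\<lambda>u. u *\<^sub>R _"] sum.If_cases cong: if_cong)
  then show "\<exists>x. combination \<phi> x = y \<and> (\<forall>i. 0 \<le> x $ i) \<and> (\<forall>i. i \<notin> I \<longrightarrow> x $ i = 0)"
    using t(2) by (intro exI[of _ "\<chi> i. if i \<in> I then t i else 0"]) auto
next
  assume "\<exists>x. combination \<phi> x = y \<and> (\<forall>i. 0 \<le> x $ i) \<and> (\<forall>i. i \<notin> I \<longrightarrow> x $ i = 0)"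
  then obtain x where x: "combination \<phi> x = y" "\<forall>i. 0 \<le> x $ i" "\<forall>i. i \<notin> I \<longrightarrow> x $ i = 0"
    by blast
  have "combination \<phi> x = (\<Sum>i\<in>I. x $ i *\<^sub>R \<phi> i)"
    unfolding combination_def by (rule sum.mono_neutral_right) (use x(3) in auto)
  then show "y \<in> cone_of \<phi> I"
    unfolding cone_of_def using x(1,2) by blast
qed

lemma cone_of_mono: "I \<subseteq> J \<Longrightarrow> cone_of \<phi> I \<subseteq> cone_of \<phi> J"
  by (force simp: cone_of_iff)

lemma cone_of_nonpos:
  assumes "y \<in> cone_of \<phi> I" "\<And>i. i \<in> I \<Longrightarrow> a \<bullet> \<phi> i \<le> 0"
  shows "a \<bullet> y \<le> 0"
proof -
  obtain x where x: "combination \<phi> x = y" "\<forall>i. 0 \<le> x $ i" "\<forall>i. i \<notin> I \<longrightarrow> x $ i = 0"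
    using assms(1) unfolding cone_of_iff by blast
  have "x $ i * (a \<bullet> \<phi> i) \<le> 0" for i
    using x assms(2) by (cases "i \<in> I") (auto intro!: mult_nonneg_nonpos)
  then show ?thesis unfolding x(1)[symmetric] inner_combination by (intro sum_nonpos) blast
qed

lemma cone_of_supportE:
  assumes "y \<in> cone_of \<phi> I"
  obtains J x where "J \<subseteq> I" "combination \<phi> x = y" "\<forall>i\<in>J. 0 < x $ i" "\<forall>i. i \<notin> J \<longrightarrow> x $ i = 0"
proof -
  obtain x where x: "combination \<phi> x = y" "\<forall>i. 0 \<le> x $ i" "\<forall>i. i \<notin> I \<longrightarrow> x $ i = 0"
    using assms cone_of_iff by blast
  show ?thesis
    by (rule that[of "{i. x $ i \<noteq> 0}" x]) (use x in \<open>auto simp: less_le\<close>)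
qed

lemma closed_cone_of: "closed (cone_of \<phi> I)"
proof -
  let ?C = "convex_cone hull (\<phi> ` I)"
  have "cone_of \<phi> I = ?C"
  proof (rule hull_unique[symmetric])
    show "\<phi> ` I \<subseteq> cone_of \<phi> I"
    proof
      fix y assume "y \<in> \<phi> ` I"
      then obtain j where "j \<in> I" "y = \<phi> j" by blast
      then show "y \<in> cone_of \<phi> I"
        unfolding cone_of_iff by (intro exI[of _ "axis j 1"]) (auto simp: axis_component)
    qed
    have add: "x + y \<in> cone_of \<phi> I" if xy: "x \<in> cone_of \<phi> I" "y \<in> cone_of \<phi> I" for x y
    proof -
      obtain u where "combination \<phi> u = x" "\<forall>i. 0 \<le> u $ i" "\<forall>i. i \<notin> I \<longrightarrow> u $ i = 0"
        using xy(1) unfolding cone_of_iff by blast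
      moreover obtain v
        where "combination \<phi> v = y" "\<forall>i. 0 \<le> v $ i" "\<forall>i. i \<notin> I \<longrightarrow> v $ i = 0"
        using xy(2) unfolding cone_of_iff by blast
      ultimately show ?thesis
        unfolding cone_of_iff by (intro exI[of _ "u + v"]) (auto simp: combination_simps)
    qed
    have scale: "c *\<^sub>R x \<in> cone_of \<phi> I" if x: "x \<in> cone_of \<phi> I" "0 \<le> c" for x c
    proof -
      obtain u where "combination \<phi> u = x" "\<forall>i. 0 \<le> u $ i" "\<forall>i. i \<notin> I \<longrightarrow> u $ i = 0"
        using x(1) unfolding cone_of_iff by blast
      then show ?thesis
        unfolding cone_of_iff using x(2)
        by (intro exI[of _ "c *\<^sub>R u"]) (auto simp: combination_simps)
    qed
    have "0 \<in> cone_of \<phi> I"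
      unfolding cone_of_iff by (intro exI[of _ 0]) (auto simp: combination_simps)
    then show "convex_cone (cone_of \<phi> I)"
      unfolding convex_cone_iff by (intro conjI ballI allI impI add scale)
    fix C assume "\<phi> ` I \<subseteq> C" "convex_cone C"
    then have C: "\<And>i. i \<in> I \<Longrightarrow> \<phi> i \<in> C" "\<And>x y. x \<in> C \<Longrightarrow> y \<in> C \<Longrightarrow> x + y \<in> C"
      "\<And>c x. 0 \<le> c \<Longrightarrow> x \<in> C \<Longrightarrow> c *\<^sub>R x \<in> C" "0 \<in> C"
      by (auto simp: convex_cone_iff)
    have "(\<Sum>i\<in>K. t i *\<^sub>R \<phi> i) \<in> C" if "finite K" "K \<subseteq> I" "\<forall>i\<in>I. 0 \<le> t i" for K t
      using that
      by (induction K rule: finite_induct) (use C in auto)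
    then show "cone_of \<phi> I \<subseteq> C"
      unfolding cone_of_def by auto
  qed
  then show ?thesis
    by (simp add: closed_convex_cone_hull)
qed

text \<open>A salient cone lies in an open half-space apart from its apex: the convex hull of the vectors
  does not contain \<open>0\<close>, since a vanishing convex combination would put the line through some
  \<open>\<phi> j\<close> into the cone. The functional makes the partition polytopes bounded.\<close>

lemma salient_positive_functional:
  fixes \<phi> :: "'n::finite \<Rightarrow> 'a::euclidean_space"
  assumes nonzero: "\<And>i. \<phi> i \<noteq> 0" and sal: "salient (cone_of \<phi> UNIV)"
  obtains \<rho> where "\<And>i. 0 < \<rho> \<bullet> \<phi> i"
proof -
  define T where "T = {u :: real ^ 'n. (\<forall>i. 0 \<le> u $ i) \<and> (\<Sum>i\<in>UNIV. u $ i) = 1}"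
  have "norm u \<le> 1" if "u \<in> T" for u
    using norm_le_l1_cart[of u] that by (simp add: T_def)
  then have "bounded T" unfolding bounded_iff by blast
  moreover have "T = (\<Inter>i. {u. 0 \<le> u $ i}) \<inter> {u. (\<Sum>i\<in>UNIV. u $ i) = 1}"
    unfolding T_def by auto
  moreover have "closed {u :: real ^ 'n. 0 \<le> u $ i}" for i
    by (intro closed_Collect_le continuous_intros)
  moreover have "closed {u :: real ^ 'n. (\<Sum>i\<in>UNIV. u $ i) = 1}"
    by (intro closed_Collect_eq continuous_intros)
  ultimately have "compact T" by (metis closed_INT closed_Int compact_eq_bounded_closed)
  moreover have "continuous_on T (combination \<phi>)"
    using linear_combination linear_continuous_on linear_conv_bounded_linear by blast
  ultimately have "closed (combination \<phi> ` T)"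
    using compact_continuous_image compact_imp_closed by blast
  moreover have "convex T"
    unfolding convex_def T_def
    by (auto simp: sum.distrib sum_distrib_left[symmetric])
  then have "convex (combination \<phi> ` T)" using convex_linear_image linear_combination by blast
  moreover have "0 \<notin> combination \<phi> ` T"
  proof
    assume "0 \<in> combination \<phi> ` T"
    then obtain u where u: "combination \<phi> u = 0" "\<And>i. 0 \<le> u $ i" "(\<Sum>i\<in>UNIV. u $ i) = 1"
      unfolding T_def by force
    have "\<exists>j. u $ j \<noteq> 0"
    proof (rule ccontr)
      assume "\<not> ?thesis"
      then show False using u(3) by simp
    qed
    then obtain j where j: "0 < u $ j" using u(2) by (metis order_le_less)
    have "t *\<^sub>R \<phi> j \<in> cone_of \<phi> UNIV" for t :: real
    proof (cases "0 \<le> t")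
      case True
      then show ?thesis
        unfolding cone_of_iff by (intro exI[of _ "axis j t"]) (auto simp: axis_component)
    next
      case False
      \<comment> \<open>\<open>- \<phi> j\<close> is a nonnegative combination of the other vectors.\<close>
      define w where "w = (- t / u $ j) *\<^sub>R u + axis j t"
      have "combination \<phi> w = t *\<^sub>R \<phi> j" using u(1) by (simp add: w_def combination_simps)
      moreover have "0 \<le> - t / u $ j" using False j by (intro divide_nonneg_pos) auto
      then have "0 \<le> - t / u $ j * u $ i" for i using u(2)[of i] by (rule mult_nonneg_nonneg)
      then have "0 \<le> w $ i" for i
        using j by (cases "i = j") (auto simp: w_def axis_component)
      ultimately show ?thesis unfolding cone_of_iff by blast
    qed
    then have "range (\<lambda>t::real. 0 + t *\<^sub>R \<phi> j) \<subseteq> cone_of \<phi> UNIV" by auto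
    then show False using sal nonzero[of j] unfolding salient_def by blast
  qed
  ultimately obtain \<rho> b where "0 < b" and \<rho>: "\<And>y. y \<in> combination \<phi> ` T \<Longrightarrow> b < \<rho> \<bullet> y"
    using separating_hyperplane_closed_0[of "combination \<phi> ` T"] by blast
  have "0 < \<rho> \<bullet> \<phi> i" for i
  proof -
    have "axis i 1 \<in> T" by (auto simp: T_def axis_component)
    then have "combination \<phi> (axis i 1) \<in> combination \<phi> ` T" by (rule imageI)
    then show ?thesis using \<rho> \<open>0 < b\<close> by fastforce
  qed
  then show ?thesis using that by blast
qed

text \<open>Since \<open>\<phi>\<close> may repeat values, and since flipping signs will change independent subsets of its range
  but not spans, walls are described by index sets and dimensions.\<close>

lemma walls_iff: "w \<in> walls \<phi> \<longleftrightarrow> (\<exists>J. w = span (\<phi> ` J) \<and> dim (\<phi> ` J) = DIM('a) - 1)"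
  for \<phi> :: "'n::finite \<Rightarrow> 'a::euclidean_space"
proof
  assume "w \<in> walls \<phi>"
  then obtain B where B: "w = span B" "B \<subseteq> range \<phi>" "independent B" "card B = DIM('a) - 1"
    unfolding walls_def by blast
  then obtain J where "B = \<phi> ` J" by (meson subset_image_iff)
  then show "\<exists>J. w = span (\<phi> ` J) \<and> dim (\<phi> ` J) = DIM('a) - 1"
    using B dim_eq_card_independent by metis
next
  assume "\<exists>J. w = span (\<phi> ` J) \<and> dim (\<phi> ` J) = DIM('a) - 1"
  then obtain J where J: "w = span (\<phi> ` J)" "dim (\<phi> ` J) = DIM('a) - 1" by blast
  obtain B where B: "B \<subseteq> \<phi> ` J" "independent B" "\<phi> ` J \<subseteq> span B" "card B = dim (\<phi> ` J)"
    using basis_exists by blast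
  have "w = span B"
    unfolding J(1) span_eq using B(1,3) span_superset by blast
  moreover have "B \<subseteq> range \<phi>" using B(1) by blast
  moreover have "card B = DIM('a) - 1" using B(4) J(2) by simp
  ultimately show "w \<in> walls \<phi>"
    unfolding walls_def using B(2) by blast
qed

lemma finite_walls: "finite (walls \<phi>)"
proof -
  have "walls \<phi> \<subseteq> (\<lambda>J. span (\<phi> ` J)) ` UNIV" using walls_iff by blast
  then show ?thesis by (rule finite_subset) simp
qed

lemma walls_hyperplane:
  assumes "w \<in> walls \<phi>"
  obtains a where "a \<noteq> 0" "w = {y. a \<bullet> y = 0}"
proof -
  obtain J where "w = span (\<phi> ` J)" "dim (\<phi> ` J) = DIM('a) - 1"
    using assms walls_iff by blast
  then have w: "subspace w" "dim w < DIM('a)" "dim w = DIM('a) - 1"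
    using DIM_positive[where 'a='a] by auto
  then obtain a where a: "a \<noteq> 0" "w \<subseteq> {y. a \<bullet> y = 0}"
    using lowdim_subset_hyperplane[of w] span_eq_iff by metis
  moreover have "dim {y. a \<bullet> y = 0} = DIM('a) - 1"
    using a(1) dim_hyperplane by blast
  ultimately have "w = {y. a \<bullet> y = 0}"
    using w subspace_dim_equal[of w "{y. a \<bullet> y = 0}"] subspace_hyperplane by force
  then show ?thesis using a(1) that by blast
qed

lemma walls_subspace: "w \<in> walls \<phi> \<Longrightarrow> subspace w"
  by (auto simp: walls_iff)

lemma walls_eq_if_subset:
  fixes \<phi> :: "'n::finite \<Rightarrow> 'a::euclidean_space"
  assumes "w \<in> walls \<phi>" "w' \<in> walls \<phi>" "w \<subseteq> w'"
  shows "w = w'"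
proof -
  have "dim w = dim w'" using assms(1,2) by (auto simp: walls_iff)
  then show ?thesis
    using subspace_dim_equal[of w w'] assms walls_subspace[OF assms(1)] walls_subspace[OF assms(2)]
    by simp
qed

lemma wall_containing:
  fixes \<phi> :: "'n::finite \<Rightarrow> 'a::euclidean_space"
  assumes gen: "span (range \<phi>) = UNIV" and "span (\<phi> ` J) \<noteq> UNIV"
  obtains w where "w \<in> walls \<phi>" "\<phi> ` J \<subseteq> w"
proof -
  obtain B where B: "B \<subseteq> \<phi> ` J" "independent B" "\<phi> ` J \<subseteq> span B"
    using maximal_independent_subset by blast
  obtain C where C: "B \<subseteq> C" "C \<subseteq> range \<phi>" "independent C" "range \<phi> \<subseteq> span C"
    using maximal_independent_subset_extend[of B "range \<phi>"] B by blast
  have "span C = UNIV"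
    using span_mono[OF C(4)] gen by (simp add: span_span top.extremum_unique)
  then have cardC: "card C = DIM('a)"
    using dim_eq_card_independent[OF C(3)] dim_span[of C] by simp
  have "finite C" using finite_subset[OF C(2)] by simp
  have "B \<noteq> C"
    using span_mono[OF B(1)] assms(2) \<open>span C = UNIV\<close> by auto
  then have "card B < card C"
    using C(1) \<open>finite C\<close> by (intro psubset_card_mono) auto
  then have "card B \<le> DIM('a) - 1"
    using cardC by simp
  then obtain D where D: "B \<subseteq> D" "D \<subseteq> C" "card D = DIM('a) - 1"
    using exists_subset_between[of B "DIM('a) - 1" C] C(1) \<open>finite C\<close> cardC by auto
  show ?thesis
  proof
    show "span D \<in> walls \<phi>"
      unfolding walls_def using D C(2) independent_mono[OF C(3) D(2)] by blast
    show "\<phi> ` J \<subseteq> span D"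
      using B(3) span_mono[OF D(1)] by blast
  qed
qed

text \<open>A point of a cone that avoids the walls uses a generating set of vectors with positive
  coefficients, and can therefore be moved in all directions.\<close>

text \<open>The map \<open>z \<mapsto> \<Sum>i\<in>J. z i \<phi> i\<close> is a surjective linear map, hence open, and the coefficients can
  vary in an open orthant.\<close>

lemma interior_cone_of:
  fixes \<phi> :: "'n::finite \<Rightarrow> 'a::euclidean_space"
  assumes span: "span (\<phi> ` J) = UNIV" and "J \<subseteq> I"
    and x: "\<forall>i\<in>J. 0 < x $ i" "\<forall>i. i \<notin> J \<longrightarrow> x $ i = 0"
  shows "combination \<phi> x \<in> interior (cone_of \<phi> I)"
proof -
  define R :: "real ^ 'n \<Rightarrow> real ^ 'n" where "R z = (\<chi> i. if i \<in> J then z $ i else 0)" for z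
  have "linear R" by (rule linearI) (auto simp: R_def vec_eq_iff)
  then have lin: "linear (combination \<phi> \<circ> R)"
    using linear_combination linear_compose by blast
  have R_id: "R z = z" if "\<forall>i. i \<notin> J \<longrightarrow> z $ i = 0" for z
    using that by (auto simp: R_def vec_eq_iff)
  have "surj (combination \<phi> \<circ> R)"
  proof -
    have "\<exists>z. y = (combination \<phi> \<circ> R) z" for y
    proof -
      have "y \<in> span (\<phi> ` J)" using span by simp
      then obtain z where "y = combination \<phi> z" "\<forall>i. i \<notin> J \<longrightarrow> z $ i = 0"
        unfolding span_image_combination by blast
      then show ?thesis using R_id by (metis comp_apply)
    qed
    then show ?thesis unfolding surj_def by blast
  qed
  define P :: "(real ^ 'n) set" where "P = (\<Inter>i\<in>J. {z. 0 < z $ i})"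
  have "open P"
    unfolding P_def by (intro open_INT) (auto intro!: open_Collect_less continuous_intros)
  then have "open ((combination \<phi> \<circ> R) ` P)"
    using open_surjective_linear_image lin \<open>surj _\<close> by blast
  moreover have "(combination \<phi> \<circ> R) ` P \<subseteq> cone_of \<phi> I"
  proof
    fix y assume "y \<in> (combination \<phi> \<circ> R) ` P"
    then obtain z where "z \<in> P" "y = combination \<phi> (R z)" by auto
    then show "y \<in> cone_of \<phi> I"
      unfolding cone_of_iff using \<open>J \<subseteq> I\<close>
      by (intro exI[of _ "R z"]) (auto simp: R_def P_def less_imp_le)
  qed
  moreover have "combination \<phi> x \<in> (combination \<phi> \<circ> R) ` P"
    using x R_id[of x] by (auto intro!: image_eqI[of _ _ x] simp: P_def)
  ultimately show ?thesis by (meson interiorI)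
qed

lemma regular_support_spans:
  assumes gen: "span (range \<phi>) = UNIV" and reg: "y \<notin> \<Union>(walls \<phi>)"
    and x: "combination \<phi> x = y" "\<forall>i. i \<notin> J \<longrightarrow> x $ i = 0"
  shows "span (\<phi> ` J) = UNIV"
proof (rule ccontr)
  assume "span (\<phi> ` J) \<noteq> UNIV"
  then obtain w where w: "w \<in> walls \<phi>" "\<phi> ` J \<subseteq> w"
    using wall_containing[OF gen] by metis
  have "y \<in> span (\<phi> ` J)" unfolding span_image_combination using x by blast
  also have "\<dots> \<subseteq> w" using span_minimal[OF w(2) walls_subspace[OF w(1)]] .
  finally show False using reg w(1) by blast
qed

lemma regular_interior_cone_of:
  assumes gen: "span (range \<phi>) = UNIV" and reg: "y \<notin> \<Union>(walls \<phi>)" and y: "y \<in> cone_of \<phi> I"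
  shows "y \<in> interior (cone_of \<phi> I)" "span (\<phi> ` I) = UNIV"
proof -
  obtain J x where J: "J \<subseteq> I" "combination \<phi> x = y" "\<forall>i\<in>J. 0 < x $ i" "\<forall>i. i \<notin> J \<longrightarrow> x $ i = 0"
    using cone_of_supportE[OF y] .
  then have span: "span (\<phi> ` J) = UNIV" using regular_support_spans[OF gen reg] by metis
  then show "y \<in> interior (cone_of \<phi> I)"
    using interior_cone_of[of \<phi> J I x] J by simp
  show "span (\<phi> ` I) = UNIV"
    using span span_mono[OF image_mono[OF J(1), of \<phi>]] by auto
qed

lemma tope_avoids_walls: "\<tau> \<in> topes \<phi> \<Longrightarrow> \<tau> \<inter> \<Union>(walls \<phi>) = {}"
  unfolding topes_def using in_components_subset[of \<tau> "- \<Union>(walls \<phi>)"] by blast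

text \<open>Membership in \<open>generating_sets \<phi> \<tau>\<close> can be tested at a single point: away from the walls, the
  points of a cone are interior points, so a cone is both open and closed relative to \<open>\<tau>\<close>.\<close>

lemma generating_sets_iff:
  assumes gen: "span (range \<phi>) = UNIV" and \<tau>: "\<tau> \<in> topes \<phi>" and y: "y \<in> \<tau>"
  shows "I \<in> generating_sets \<phi> \<tau> \<longleftrightarrow> y \<in> cone_of \<phi> I"
proof
  assume yI: "y \<in> cone_of \<phi> I"
  have reg: "z \<notin> \<Union>(walls \<phi>)" if "z \<in> \<tau>" for z
    using that tope_avoids_walls[OF \<tau>] by blast
  have "connected \<tau>" using \<tau>[unfolded topes_def] by (rule in_components_connected)
  moreover have "\<tau> \<subseteq> interior (cone_of \<phi> I) \<union> - cone_of \<phi> I"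
    using regular_interior_cone_of(1)[OF gen reg] by blast
  moreover have "interior (cone_of \<phi> I) \<inter> (- cone_of \<phi> I) \<inter> \<tau> = {}"
    using interior_subset[of "cone_of \<phi> I"] by blast
  moreover have "interior (cone_of \<phi> I) \<inter> \<tau> \<noteq> {}"
    using regular_interior_cone_of(1)[OF gen reg] yI y by blast
  ultimately have "- cone_of \<phi> I \<inter> \<tau> = {}"
    using connectedD[of \<tau> "interior (cone_of \<phi> I)" "- cone_of \<phi> I"]
      open_Compl[OF closed_cone_of[of \<phi> I]] by blast
  then show "I \<in> generating_sets \<phi> \<tau>"
    unfolding generating_sets_def
    using regular_interior_cone_of(2)[OF gen reg[OF y] yI] by blast
qed (use y in \<open>auto simp: generating_sets_def\<close>)

lemma tope_hyperplane_side:
  assumes \<tau>: "\<tau> \<in> topes \<phi>" and w: "{y. a \<bullet> y = 0} \<in> walls \<phi>"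
  shows "\<tau> \<subseteq> {y. 0 < a \<bullet> y} \<or> \<tau> \<subseteq> {y. a \<bullet> y < 0}"
proof (rule ccontr)
  assume "\<not> ?thesis"
  then obtain y z where yz: "y \<in> \<tau>" "a \<bullet> y \<le> 0" "z \<in> \<tau>" "0 \<le> a \<bullet> z"
    by (auto simp: subset_iff not_less)
  have "connected \<tau>" using \<tau>[unfolded topes_def] by (rule in_components_connected)
  then obtain u where "u \<in> \<tau>" "a \<bullet> u = 0"
    using connected_ivt_hyperplane[OF _ yz(1,3,2,4)] by auto
  then have "u \<in> \<Union>(walls \<phi>)" using w by blast
  then show False using tope_avoids_walls[OF \<tau>] \<open>u \<in> \<tau>\<close> by blast
qed

lemma convex_tope:
  assumes \<tau>: "\<tau> \<in> topes \<phi>"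
  shows "convex \<tau>"
  unfolding convex_contains_segment
proof (intro ballI)
  fix u v assume uv: "u \<in> \<tau>" "v \<in> \<tau>"
  have "closed_segment u v \<inter> w = {}" if w: "w \<in> walls \<phi>" for w
  proof -
    obtain a where a: "w = {y. a \<bullet> y = 0}" using walls_hyperplane[OF w] by blast
    have "closed_segment u v \<subseteq> {y. 0 < a \<bullet> y} \<or> closed_segment u v \<subseteq> {y. a \<bullet> y < 0}"
      using tope_hyperplane_side[OF \<tau> w[unfolded a]]
    proof
      assume "\<tau> \<subseteq> {y. 0 < a \<bullet> y}"
      then show ?thesis
        using closed_segment_subset[OF _ _ convex_halfspace_gt[of 0 a]] uv by blast
    next
      assume "\<tau> \<subseteq> {y. a \<bullet> y < 0}"
      then show ?thesis
        using closed_segment_subset[OF _ _ convex_halfspace_lt[of a 0]] uv by blast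
    qed
    then show ?thesis unfolding a by force
  qed
  then have "closed_segment u v \<subseteq> - \<Union>(walls \<phi>)" by blast
  then show "closed_segment u v \<subseteq> \<tau>"
    using components_maximal[of \<tau> "- \<Union>(walls \<phi>)" "closed_segment u v"] \<tau> uv
    unfolding topes_def by (metis connected_segment disjoint_iff ends_in_segment(1))
qed

section \<open>Linear programs with generic cost\<close>

text \<open>The bases of the linear program: for \<open>l\<close> off the walls, these are the supports of the vertices of
  the partition polytope. Independence is stated for the index set, through linear relations,
  so that repeated vectors are treated as dependent.\<close>

definition vertex_sets :: "('n::finite \<Rightarrow> 'a::euclidean_space) \<Rightarrow> 'a \<Rightarrow> 'n set set" where
  "vertex_sets \<phi> l = {b. l \<in> cone_of \<phi> b \<and>
     (\<forall>d. combination \<phi> d = 0 \<longrightarrow> (\<forall>i. i \<notin> b \<longrightarrow> d $ i = 0) \<longrightarrow> d = 0)}"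

lemma vertex_set_relation:
  assumes "b \<in> vertex_sets \<phi> l" "combination \<phi> d = 0" "\<And>i. i \<notin> b \<Longrightarrow> d $ i = 0"
  shows "d = 0"
  using assms unfolding vertex_sets_def by blast

lemma vertex_set_independent:
  assumes b: "b \<in> vertex_sets \<phi> l"
  shows "inj_on \<phi> b" "independent (\<phi> ` b)"
proof -
  show "inj_on \<phi> b"
  proof (rule inj_onI, rule ccontr)
    fix i j assume ij: "i \<in> b" "j \<in> b" "\<phi> i = \<phi> j" "i \<noteq> j"
    have "axis i 1 - axis j 1 = (0 :: real ^ 'a)"
      by (rule vertex_set_relation[OF b]) (use ij in \<open>auto simp: combination_simps axis_component\<close>)
    then have "(axis i 1 - axis j (1::real)) $ i = 0" by simp
    then show False using ij by (simp add: axis_component)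
  qed
  show "independent (\<phi> ` b)"
    unfolding dependent_def
  proof safe
    fix j assume j: "j \<in> b" "\<phi> j \<in> span (\<phi> ` b - {\<phi> j})"
    have "\<phi> ` b - {\<phi> j} \<subseteq> \<phi> ` (b - {j})" by blast
    then have "\<phi> j \<in> span (\<phi> ` (b - {j}))" using j(2) span_mono by blast
    then obtain z where z: "\<phi> j = combination \<phi> z" "\<forall>i. i \<notin> b - {j} \<longrightarrow> z $ i = 0"
      unfolding span_image_combination by blast
    have "axis j 1 - z = 0"
      by (rule vertex_set_relation[OF b]) (use j z in \<open>auto simp: combination_simps axis_component\<close>)
    then have "(axis j 1 - z) $ j = 0" by simp
    then show False using z(2) by (simp add: axis_component)
  qed
qed

lemma vertex_set_point:
  fixes \<phi> :: "'n::finite \<Rightarrow> 'a::euclidean_space"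
  assumes gen: "span (range \<phi>) = UNIV" and reg: "l \<notin> \<Union>(walls \<phi>)" and b: "b \<in> vertex_sets \<phi> l"
  obtains v where "combination \<phi> v = l" "\<forall>i\<in>b. 0 < v $ i" "\<forall>i. i \<notin> b \<longrightarrow> v $ i = 0"
proof -
  have "l \<in> cone_of \<phi> b" using b unfolding vertex_sets_def by blast
  then obtain J v where J: "J \<subseteq> b" "combination \<phi> v = l" "\<forall>i\<in>J. 0 < v $ i" "\<forall>i. i \<notin> J \<longrightarrow> v $ i = 0"
    using cone_of_supportE[of l \<phi> b] by metis
  have "span (\<phi> ` J) = UNIV" using regular_support_spans[OF gen reg J(2,4)] .
  have "b \<subseteq> J"
  proof (rule ccontr)
    assume "\<not> b \<subseteq> J"
    then obtain j where j: "j \<in> b" "j \<notin> J" by blast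
    have "\<phi> j \<in> span (\<phi> ` J)" using \<open>span (\<phi> ` J) = UNIV\<close> by simp
    then obtain z where z: "\<phi> j = combination \<phi> z" "\<forall>i. i \<notin> J \<longrightarrow> z $ i = 0"
      unfolding span_image_combination by blast
    have "axis j 1 - z = 0"
      by (rule vertex_set_relation[OF b])
        (use j z J(1) in \<open>auto simp: combination_simps axis_component\<close>)
    then have "(axis j 1 - z) $ j = 0" by simp
    then show False using z(2) j(2) by (simp add: axis_component)
  qed
  then have "J = b" using J(1) by blast
  then show ?thesis using that J by metis
qed

lemma vertex_set_span:
  fixes \<phi> :: "'n::finite \<Rightarrow> 'a::euclidean_space"
  assumes gen: "span (range \<phi>) = UNIV" and reg: "l \<notin> \<Union>(walls \<phi>)" and b: "b \<in> vertex_sets \<phi> l"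
  shows "span (\<phi> ` b) = UNIV" "card b = DIM('a)"
proof -
  obtain v where "combination \<phi> v = l" "\<forall>i. i \<notin> b \<longrightarrow> v $ i = 0"
    using vertex_set_point[OF assms] by metis
  then show span: "span (\<phi> ` b) = UNIV" using regular_support_spans[OF gen reg] by metis
  have "card b = card (\<phi> ` b)" using card_image[OF vertex_set_independent(1)[OF b]] by simp
  also have "\<dots> = dim (span (\<phi> ` b))"
    using dim_eq_card_independent[OF vertex_set_independent(2)[OF b]] by simp
  finally show "card b = DIM('a)" using span by simp
qed

text \<open>The dual solution at a vertex: the multipliers that make the cost vanish on the basis.\<close>

lemma vertex_set_multiplier_exists:
  fixes \<phi> :: "'n::finite \<Rightarrow> 'a::euclidean_space"
  assumes b: "b \<in> vertex_sets \<phi> l"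
  shows "\<exists>y. \<forall>i\<in>b. y \<bullet> \<phi> i = c $ i"
proof -
  obtain g :: "'a \<Rightarrow> real"
    where g: "linear g" "\<forall>x\<in>\<phi> ` b. g x = c $ inv_into b \<phi> x"
    using linear_independent_extend[OF vertex_set_independent(2)[OF b], of "\<lambda>x. c $ inv_into b \<phi> x"]
    by blast
  have "adjoint g 1 \<bullet> \<phi> i = c $ i" if "i \<in> b" for i
    using adjoint_works[OF g(1), of "\<phi> i" 1] g(2) that
      inv_into_f_f[OF vertex_set_independent(1)[OF b]]
    by (simp add: inner_commute)
  then show ?thesis by blast
qed

lemma multiplier_unique:
  assumes "span (\<phi> ` b) = UNIV" "\<forall>i\<in>b. y \<bullet> \<phi> i = c $ i" "\<forall>i\<in>b. y' \<bullet> \<phi> i = c $ i"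
  shows "y = y'"
proof -
  have "\<phi> ` b \<subseteq> {z. (y - y') \<bullet> z = 0}" using assms(2,3) by (auto simp: inner_diff_left)
  then have "span (\<phi> ` b) \<subseteq> {z. (y - y') \<bullet> z = 0}"
    using subspace_hyperplane by (rule span_minimal)
  then have "(y - y') \<bullet> (y - y') = 0" using assms(1) by blast
  then show ?thesis by simp
qed

text \<open>The basic identity of linear programming duality: \<open>c $ i - y \<bullet> \<phi> i\<close> is the reduced cost of \<open>i\<close>
  for the multiplier \<open>y\<close>, and all comparisons of costs below are read off from the signs of its terms.\<close>

lemma reduced_cost_sum:
  assumes "combination \<phi> v = l"
  shows "(\<Sum>i\<in>UNIV. v $ i * (c $ i - y \<bullet> \<phi> i)) = c \<bullet> v - y \<bullet> l"
proof -
  have "y \<bullet> l = (\<Sum>i\<in>UNIV. v $ i * (y \<bullet> \<phi> i))"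
    using inner_combination[of y \<phi> v] assms by simp
  moreover have "c \<bullet> v = (\<Sum>i\<in>UNIV. v $ i * c $ i)"
    by (simp add: inner_vec_def mult.commute)
  ultimately show ?thesis by (simp add: right_diff_distrib sum_subtractf)
qed

text \<open>Dual nondegeneracy, which makes the optimal basis of a linear program unique.\<close>

definition generic_cost :: "('n::finite \<Rightarrow> 'a::euclidean_space) \<Rightarrow> 'a \<Rightarrow> real ^ 'n \<Rightarrow> bool" where
  "generic_cost \<phi> l c \<longleftrightarrow>
     (\<forall>b\<in>vertex_sets \<phi> l. \<forall>y. (\<forall>i\<in>b. y \<bullet> \<phi> i = c $ i) \<longrightarrow> (\<forall>j. j \<notin> b \<longrightarrow> y \<bullet> \<phi> j \<noteq> c $ j))"

lemma generic_cost_uminus: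
  assumes "generic_cost \<phi> l c"
  shows "generic_cost \<phi> l (- c)"
  unfolding generic_cost_def
proof (intro ballI allI impI)
  fix b y j assume *: "b \<in> vertex_sets \<phi> l" "\<forall>i\<in>b. y \<bullet> \<phi> i = (- c) $ i" "j \<notin> b"
  then have "\<forall>i\<in>b. (- y) \<bullet> \<phi> i = c $ i" by simp
  then have "(- y) \<bullet> \<phi> j \<noteq> c $ j" using assms * unfolding generic_cost_def by blast
  then show "y \<bullet> \<phi> j \<noteq> (- c) $ j" by auto
qed

text \<open>For each basis \<open>b\<close> and each \<open>j\<close> outside it, the vectors indexed by \<open>insert j b\<close> satisfy a relation with
  coefficient \<open>1\<close> at \<open>j\<close>; the reduced cost of \<open>j\<close> is the inner product of \<open>c\<close> with this
  relation. So the costs that fail to be generic lie on finitely many hyperplanes.\<close>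

lemma generic_cost_dense:
  fixes \<phi> :: "'n::finite \<Rightarrow> 'a::euclidean_space"
  assumes gen: "span (range \<phi>) = UNIV" and reg: "l \<notin> \<Union>(walls \<phi>)"
    and U: "open U" "U \<noteq> {}"
  shows "\<exists>c\<in>U. generic_cost \<phi> l c"
proof -
  have "\<exists>w. combination \<phi> w = 0 \<and> w $ j = 1 \<and> (\<forall>i. i \<notin> insert j b \<longrightarrow> w $ i = 0)"
    if b: "b \<in> vertex_sets \<phi> l" and j: "j \<notin> b" for b j
  proof -
    have "\<phi> j \<in> span (\<phi> ` b)" using vertex_set_span(1)[OF gen reg b] by simp
    then obtain z where z: "\<phi> j = combination \<phi> z" "\<forall>i. i \<notin> b \<longrightarrow> z $ i = 0"
      unfolding span_image_combination by blast
    show ?thesis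
      by (rule exI[of _ "axis j 1 - z"])
        (use z j in \<open>auto simp: combination_simps axis_component\<close>)
  qed
  then obtain W where W: "combination \<phi> (W b j) = 0" "W b j $ j = 1"
      "i \<notin> insert j b \<Longrightarrow> W b j $ i = 0"
    if "b \<in> vertex_sets \<phi> l" "j \<notin> b" for b i j
    by metis
  define Z where "Z = (\<lambda>(b, j). {c. W b j \<bullet> c = 0}) ` {(b, j). b \<in> vertex_sets \<phi> l \<and> j \<notin> b}"
  \<comment> \<open>\<open>Z\<close> consists of the hyperplanes on which some reduced cost vanishes.\<close>
  have "negligible (\<Union>Z)"
  proof (rule negligible_Union)
    show "finite Z" unfolding Z_def by simp
    fix H assume "H \<in> Z"
    then obtain b j where bj: "b \<in> vertex_sets \<phi> l" "j \<notin> b" "H = {c. W b j \<bullet> c = 0}"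
      unfolding Z_def by blast
    have "W b j \<noteq> 0" using W(2)[OF bj(1,2)] by auto
    then show "negligible H" using negligible_hyperplane bj(3) by blast
  qed
  then have "\<not> U \<subseteq> \<Union>Z"
    using open_not_negligible[OF U] negligible_subset by blast
  then obtain c where c: "c \<in> U" "c \<notin> \<Union>Z" by blast
  have "generic_cost \<phi> l c"
    unfolding generic_cost_def
  proof (intro ballI allI impI notI)
    fix b y j assume b: "b \<in> vertex_sets \<phi> l" and y: "\<forall>i\<in>b. y \<bullet> \<phi> i = c $ i"
      and j: "j \<notin> b" "y \<bullet> \<phi> j = c $ j"
    have "W b j $ i * (c $ i - y \<bullet> \<phi> i) = 0" for i
      using W(3)[OF b j(1), of i] y j(2) by (cases "i \<in> insert j b") auto
    then have "(\<Sum>i\<in>UNIV. W b j $ i * (c $ i - y \<bullet> \<phi> i)) = 0"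
      by (intro sum.neutral) blast
    then have "c \<bullet> W b j = y \<bullet> combination \<phi> (W b j)"
      using reduced_cost_sum[of \<phi> "W b j" _ c y] by simp
    then have "W b j \<bullet> c = 0" using W(1)[OF b j(1)] by (simp add: inner_commute)
    then show False using c(2) b j(1) unfolding Z_def by blast
  qed
  then show ?thesis using c(1) by blast
qed

lemma bounded_partition_polytope:
  assumes \<rho>: "\<And>i. 0 < \<rho> \<bullet> \<phi> i"
  shows "bounded (partition_polytope \<phi> l)"
  unfolding bounded_iff
proof (intro exI ballI)
  fix v assume "v \<in> partition_polytope \<phi> l"
  then have v: "combination \<phi> v = l" "\<And>i. 0 \<le> v $ i"
    unfolding partition_polytope_def by (auto simp: affine_fibre_iff)
  have "\<bar>v $ i\<bar> \<le> (\<rho> \<bullet> l) / (\<rho> \<bullet> \<phi> i)" for i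
  proof -
    have "v $ i * (\<rho> \<bullet> \<phi> i) \<le> (\<Sum>j\<in>UNIV. v $ j * (\<rho> \<bullet> \<phi> j))"
      by (rule member_le_sum) (use v(2) \<rho> in \<open>auto simp: less_imp_le\<close>)
    also have "\<dots> = \<rho> \<bullet> l" using inner_combination[of \<rho> \<phi> v] v(1) by simp
    finally show ?thesis using \<rho>[of i] v(2)[of i] by (simp add: pos_le_divide_eq)
  qed
  then have "(\<Sum>i\<in>UNIV. \<bar>v $ i\<bar>) \<le> (\<Sum>i\<in>UNIV. (\<rho> \<bullet> l) / (\<rho> \<bullet> \<phi> i))"
    by (intro sum_mono)
  then show "norm v \<le> (\<Sum>i\<in>UNIV. (\<rho> \<bullet> l) / (\<rho> \<bullet> \<phi> i))"
    using norm_le_l1_cart[of v] by simp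
qed

text \<open>The pivot step of the simplex algorithm: moving from \<open>v\<close> in the direction \<open>d\<close>, stop when the
  first coordinate vanishes.\<close>

lemma ratio_test:
  fixes v d :: "real ^ 'n::finite"
  assumes v: "\<And>i. 0 \<le> v $ i" "\<And>i. d $ i < 0 \<Longrightarrow> 0 < v $ i" and ex: "d $ k < 0"
  obtains t i where "0 < t" "\<And>i. 0 \<le> (v + t *\<^sub>R d) $ i" "d $ i < 0" "(v + t *\<^sub>R d) $ i = 0"
proof -
  define D where "D = {i. d $ i < 0}"
  define t where "t = Min ((\<lambda>i. v $ i / (- d $ i)) ` D)"
  have D: "finite D" "D \<noteq> {}" using ex by (auto simp: D_def)
  then have "t \<in> (\<lambda>i. v $ i / (- d $ i)) ` D" unfolding t_def by (intro Min_in) auto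
  then obtain i where i: "i \<in> D" "t = v $ i / (- d $ i)" by blast
  have t_le: "t \<le> v $ j / (- d $ j)" if "j \<in> D" for j
    unfolding t_def using D that by (intro Min_le) auto
  show ?thesis
  proof (rule that[of t i])
    show "0 < t" unfolding i(2) using i(1) v(2)[of i] by (intro divide_pos_pos) (auto simp: D_def)
    show "0 \<le> (v + t *\<^sub>R d) $ j" for j
    proof (cases "j \<in> D")
      case True
      then show ?thesis using t_le[OF True] by (simp add: D_def field_simps)
    next
      case False
      then show ?thesis using \<open>0 < t\<close> v(1)[of j] by (simp add: D_def)
    qed
    show "d $ i < 0" using i(1) by (simp add: D_def)
    then show "(v + t *\<^sub>R d) $ i = 0" using i(2) by simp
  qed
qed

lemma relation_has_negative_entry:
  assumes \<rho>: "\<And>i. 0 < \<rho> \<bullet> \<phi> i" and d: "combination \<phi> d = 0" "d \<noteq> 0"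
  shows "\<exists>i. d $ i < 0"
proof (rule ccontr)
  assume "\<not> ?thesis"
  then have nonneg: "0 \<le> d $ i" for i by (simp add: not_less)
  have "(\<Sum>i\<in>UNIV. d $ i * (\<rho> \<bullet> \<phi> i)) = 0"
    using inner_combination[of \<rho> \<phi> d] d(1) by simp
  then have "\<forall>i\<in>UNIV. d $ i * (\<rho> \<bullet> \<phi> i) = 0"
    by (subst (asm) sum_nonneg_eq_0_iff) (use nonneg \<rho> in \<open>auto simp: less_imp_le\<close>)
  then have "d $ i = 0" for i using \<rho>[of i] by (metis UNIV_I less_irrefl mult_eq_0_iff)
  then show False using d(2) by (simp add: vec_eq_iff)
qed

text \<open>The face supported on \<open>I\<close> is compact, so the cost has a minimum on it. A minimiser of smallest
  support has independent support, as otherwise it could be moved along a relation without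
  increasing the cost until a coordinate vanishes; and a negative reduced cost would give a direction that
  lowers the cost.\<close>

lemma optimal_vertex_set_exists:
  fixes \<phi> :: "'n::finite \<Rightarrow> 'a::euclidean_space"
  assumes gen: "span (range \<phi>) = UNIV" and \<rho>: "\<And>i. 0 < \<rho> \<bullet> \<phi> i"
    and reg: "l \<notin> \<Union>(walls \<phi>)" and c: "generic_cost \<phi> l c" and lI: "l \<in> cone_of \<phi> I"
  obtains b y where "b \<in> vertex_sets \<phi> l" "b \<subseteq> I"
    "\<forall>i\<in>b. y \<bullet> \<phi> i = c $ i" "\<forall>j\<in>I - b. y \<bullet> \<phi> j < c $ j"
proof -
  define P where "P = {v. combination \<phi> v = l \<and> (\<forall>i. 0 \<le> v $ i) \<and> (\<forall>i. i \<notin> I \<longrightarrow> v $ i = 0)}"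
  have "P \<subseteq> partition_polytope \<phi> l"
    unfolding P_def partition_polytope_def by (auto simp: affine_fibre_iff)
  then have "bounded P" using bounded_partition_polytope[of \<rho> \<phi> l, OF \<rho>] bounded_subset by metis
  have "continuous_on UNIV (combination \<phi>)"
    using linear_combination linear_continuous_on linear_conv_bounded_linear by blast
  then have "closed {v. combination \<phi> v = l}"
    by (intro closed_Collect_eq) auto
  moreover have "P = {v. combination \<phi> v = l} \<inter> (\<Inter>i. {v. 0 \<le> v $ i}) \<inter> (\<Inter>i\<in>- I. {v. v $ i = 0})"
    unfolding P_def by auto
  moreover have "closed {v :: real ^ 'n. 0 \<le> v $ i}" "closed {v :: real ^ 'n. v $ i = 0}" for i
    by (auto intro!: closed_Collect_le closed_Collect_eq continuous_intros)
  ultimately have "closed P" by (metis closed_INT closed_Int)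
  then have "compact P" using \<open>bounded P\<close> compact_eq_bounded_closed by blast
  moreover have "P \<noteq> {}" using lI unfolding cone_of_iff P_def by blast
  moreover have "continuous_on P (\<lambda>v. c \<bullet> v)" by (intro continuous_intros)
  ultimately obtain v0 where v0: "v0 \<in> P" "\<forall>v\<in>P. c \<bullet> v0 \<le> c \<bullet> v"
    using continuous_attains_inf[of P "\<lambda>v. c \<bullet> v"] by blast
  define opt where "opt v \<longleftrightarrow> v \<in> P \<and> (\<forall>u\<in>P. c \<bullet> v \<le> c \<bullet> u)" for v
  define supp where "supp v = {i. v $ i \<noteq> 0}" for v :: "real ^ 'n"
  have "opt v0" using v0 by (simp add: opt_def)
  then obtain v where v: "opt v" and min: "\<And>u. card (supp u) < card (supp v) \<Longrightarrow> \<not> opt u"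
    using ex_has_least_nat[of opt v0 "\<lambda>u. card (supp u)"] by (metis not_less)
  have vP: "combination \<phi> v = l" "\<And>i. 0 \<le> v $ i" "\<And>i. i \<notin> I \<Longrightarrow> v $ i = 0"
    using v unfolding opt_def P_def by auto
  define b where "b = supp v"
  have pos: "0 < v $ i" if "i \<in> b" for i
    using that vP(2)[of i] by (simp add: b_def supp_def less_le)
  have "b \<subseteq> I" using vP(3) unfolding b_def supp_def by blast
  \<comment> \<open>A cost-reducing relation whose negative entries lie in the support can be followed until a
    coordinate of \<open>v\<close> vanishes.\<close>
  have move: False
    if d: "combination \<phi> d = 0" "d \<noteq> 0" "\<And>i. d $ i < 0 \<Longrightarrow> i \<in> b" "\<And>i. i \<notin> I \<Longrightarrow> d $ i = 0"
      and cost: "c \<bullet> d \<le> 0" "c \<bullet> d < 0 \<or> (\<forall>i. i \<notin> b \<longrightarrow> d $ i = 0)" for d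
  proof -
    obtain k where "d $ k < 0" using relation_has_negative_entry[of \<rho> \<phi>, OF \<rho> d(1,2)] by blast
    then obtain t i where t: "0 < t" "\<And>i. 0 \<le> (v + t *\<^sub>R d) $ i"
      and i: "d $ i < 0" "(v + t *\<^sub>R d) $ i = 0"
      using ratio_test[of v d k] vP(2) d(3) pos by metis
    let ?u = "v + t *\<^sub>R d"
    have "?u \<in> P"
      unfolding P_def using t(2) vP d by (auto simp: combination_simps)
    have cu: "c \<bullet> ?u = c \<bullet> v + t * (c \<bullet> d)" by (simp add: inner_add_right)
    show False
    proof (cases "c \<bullet> d < 0")
      case True
      then have "t * (c \<bullet> d) < 0" using t(1) by (rule mult_pos_neg[rotated])
      then have "c \<bullet> ?u < c \<bullet> v" using cu by linarith
      then show False using v \<open>?u \<in> P\<close> unfolding opt_def by force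
    next
      case False
      then have "c \<bullet> ?u = c \<bullet> v" "\<forall>i. i \<notin> b \<longrightarrow> d $ i = 0" using cu cost by auto
      then have "opt ?u" using v \<open>?u \<in> P\<close> unfolding opt_def by simp
      have "supp ?u \<subseteq> supp v"
        using \<open>\<forall>i. i \<notin> b \<longrightarrow> d $ i = 0\<close> by (auto simp: supp_def b_def)
      moreover have "i \<in> supp v" "i \<notin> supp ?u"
        using i d(3)[OF i(1)] by (auto simp: supp_def b_def)
      ultimately have "card (supp ?u) < card (supp v)"
        by (intro psubset_card_mono) auto
      then show False using min \<open>opt ?u\<close> by blast
    qed
  qed
  have "d = 0" if d: "combination \<phi> d = 0" "\<forall>i. i \<notin> b \<longrightarrow> d $ i = 0" for d
  proof (rule ccontr)
    assume "d \<noteq> 0"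
    consider "c \<bullet> d \<le> 0" | "c \<bullet> (- d) \<le> 0" by fastforce
    then show False
    proof cases
      case 1
      show False by (rule move[of d]) (use d \<open>d \<noteq> 0\<close> 1 \<open>b \<subseteq> I\<close> in auto)
    next
      case 2
      show False
        by (rule move[of "- d"]) (use d \<open>d \<noteq> 0\<close> 2 \<open>b \<subseteq> I\<close> in \<open>auto simp: combination_simps\<close>)
    qed
  qed
  moreover have "l \<in> cone_of \<phi> b"
    unfolding cone_of_iff using vP by (intro exI[of _ v]) (auto simp: b_def supp_def)
  ultimately have b: "b \<in> vertex_sets \<phi> l"
    unfolding vertex_sets_def by blast
  obtain y where y: "\<forall>i\<in>b. y \<bullet> \<phi> i = c $ i"
    using vertex_set_multiplier_exists[OF b] by blast
  have "y \<bullet> \<phi> j < c $ j" if j: "j \<in> I - b" for j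
  proof (rule ccontr)
    assume "\<not> y \<bullet> \<phi> j < c $ j"
    moreover have "y \<bullet> \<phi> j \<noteq> c $ j" using c b y j unfolding generic_cost_def by blast
    ultimately have less: "c $ j < y \<bullet> \<phi> j" by simp
    have "\<phi> j \<in> span (\<phi> ` b)" using vertex_set_span(1)[OF gen reg b] by simp
    then obtain z where z: "\<phi> j = combination \<phi> z" "\<forall>i. i \<notin> b \<longrightarrow> z $ i = 0"
      unfolding span_image_combination by blast
    define d where "d = axis j 1 - z"
    have d: "combination \<phi> d = 0" "\<And>i. i \<notin> b \<Longrightarrow> d $ i = (if i = j then 1 else 0)"
      using z by (auto simp: d_def combination_simps axis_component)
    have "d $ i * (c $ i - y \<bullet> \<phi> i) = (if i = j then c $ j - y \<bullet> \<phi> j else 0)" for i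
      using d(2)[of i] y j by (cases "i \<in> b") auto
    then have "c \<bullet> d = c $ j - y \<bullet> \<phi> j"
      using reduced_cost_sum[OF d(1), of c y] by simp
    then have "c \<bullet> d < 0" using less by simp
    show False
    proof (rule move[of d])
      show "d \<noteq> 0" using \<open>c \<bullet> d < 0\<close> by auto
      show "i \<in> b" if "d $ i < 0" for i
        using that d(2)[of i] by (cases "i \<in> b") (auto split: if_splits)
      show "d $ i = 0" if "i \<notin> I" for i
        using that d(2)[of i] j \<open>b \<subseteq> I\<close> by (cases "i = j") auto
    qed (use d \<open>c \<bullet> d < 0\<close> in auto)
  qed
  then show ?thesis using that b \<open>b \<subseteq> I\<close> y by blast
qed

text \<open>Every point of the face supported on \<open>I\<close> costs at least \<open>y \<bullet> l\<close>, with equality only if its support lies in \<open>b\<close>. Applying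
  this to the vertices of both bases shows that the two supports agree.\<close>

lemma optimal_vertex_set_unique:
  fixes \<phi> :: "'n::finite \<Rightarrow> 'a::euclidean_space"
  assumes gen: "span (range \<phi>) = UNIV" and reg: "l \<notin> \<Union>(walls \<phi>)"
    and b: "b \<in> vertex_sets \<phi> l" "b \<subseteq> I" "\<forall>i\<in>b. y \<bullet> \<phi> i = c $ i" "\<forall>j\<in>I - b. y \<bullet> \<phi> j < c $ j"
    and b': "b' \<in> vertex_sets \<phi> l" "b' \<subseteq> I" "\<forall>i\<in>b'. y' \<bullet> \<phi> i = c $ i"
      "\<forall>j\<in>I - b'. y' \<bullet> \<phi> j < c $ j"
  shows "b = b'"
proof -
  have step: "y \<bullet> l \<le> y' \<bullet> l \<and> (y \<bullet> l = y' \<bullet> l \<longrightarrow> b' \<subseteq> b)"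
    if b: "b \<in> vertex_sets \<phi> l" "\<forall>i\<in>b. y \<bullet> \<phi> i = c $ i" "\<forall>j\<in>I - b. y \<bullet> \<phi> j < c $ j"
      and b': "b' \<in> vertex_sets \<phi> l" "b' \<subseteq> I" "\<forall>i\<in>b'. y' \<bullet> \<phi> i = c $ i"
    for b b' y y'
  proof -
    obtain v where v: "combination \<phi> v = l" "\<forall>i\<in>b'. 0 < v $ i" "\<forall>i. i \<notin> b' \<longrightarrow> v $ i = 0"
      using vertex_set_point[OF gen reg b'(1)] by blast
    have nonneg: "0 \<le> v $ i * (c $ i - y \<bullet> \<phi> i)" for i
    proof (cases "i \<in> b'")
      case True
      then have "y \<bullet> \<phi> i \<le> c $ i" using b(2,3) b'(2) by (cases "i \<in> b") (auto simp: less_imp_le)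
      then show ?thesis using v(2) True by (simp add: less_imp_le)
    qed (use v(3) in auto)
    have "v $ i * (c $ i - y' \<bullet> \<phi> i) = 0" for i
      using v(3) b'(3) by (cases "i \<in> b'") auto
    then have "(\<Sum>i\<in>UNIV. v $ i * (c $ i - y' \<bullet> \<phi> i)) = 0" by (intro sum.neutral) blast
    then have y': "c \<bullet> v = y' \<bullet> l" using reduced_cost_sum[OF v(1), of c y'] by simp
    have sum: "(\<Sum>i\<in>UNIV. v $ i * (c $ i - y \<bullet> \<phi> i)) = y' \<bullet> l - y \<bullet> l"
      using reduced_cost_sum[OF v(1), of c y] y' by simp
    have "0 \<le> (\<Sum>i\<in>UNIV. v $ i * (c $ i - y \<bullet> \<phi> i))" by (rule sum_nonneg) (rule nonneg)
    moreover have "b' \<subseteq> b" if "y \<bullet> l = y' \<bullet> l"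
    proof
      fix i assume i: "i \<in> b'"
      have "(\<Sum>i\<in>UNIV. v $ i * (c $ i - y \<bullet> \<phi> i)) = 0" using sum that by simp
      then have "v $ i * (c $ i - y \<bullet> \<phi> i) = 0"
        using sum_nonneg_eq_0_iff[of UNIV "\<lambda>i. v $ i * (c $ i - y \<bullet> \<phi> i)"] nonneg by simp
      then show "i \<in> b" using v(2) i b(3) b'(2) by force
    qed
    ultimately show ?thesis using sum by auto
  qed
  have 1: "y \<bullet> l \<le> y' \<bullet> l \<and> (y \<bullet> l = y' \<bullet> l \<longrightarrow> b' \<subseteq> b)" using step[OF b(1,3,4) b'(1-3)] .
  have 2: "y' \<bullet> l \<le> y \<bullet> l \<and> (y' \<bullet> l = y \<bullet> l \<longrightarrow> b \<subseteq> b')" using step[OF b'(1,3,4) b(1-3)] .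
  have "y \<bullet> l = y' \<bullet> l" using 1 2 by linarith
  then show ?thesis using 1 2 by auto
qed

section \<open>The Brianchon-Gram identity\<close>

text \<open>The case of a point lying over the tope itself. In terms of polytopes, \<open>I\<close> runs through the faces and
  the proof assigns each face to its \<open>c\<close>-minimal vertex.\<close>

theorem brianchon_gram_sum:
  fixes \<phi> :: "'n::finite \<Rightarrow> 'a::euclidean_space"
  assumes gen: "span (range \<phi>) = UNIV" and \<rho>: "\<And>i. 0 < \<rho> \<bullet> \<phi> i"
    and reg: "l \<notin> \<Union>(walls \<phi>)" and x: "combination \<phi> x = l"
  shows "(\<Sum>I | l \<in> cone_of \<phi> I \<and> {i. x $ i < 0} \<subseteq> I. (- 1) ^ card I :: real) =
    (if {i. x $ i < 0} = {} then (- 1) ^ DIM('a) else 0)"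
proof -
  define N where "N = {i. x $ i < 0}"
  define U where "U = (if N = {} then UNIV else {c. \<forall>v\<in>partition_polytope \<phi> l. c \<bullet> v < c \<bullet> x})"
  \<comment> \<open>If \<open>x\<close> lies outside the polytope, a coordinate \<open>e \<in> N\<close> separates it from the polytope,
    and this remains true for all costs near \<open>- axis e 1\<close> since the polytope is bounded.\<close>
  have "interior U \<noteq> {}"
  proof (cases "N = {}")
    case False
    then obtain e where e: "x $ e < 0" unfolding N_def by blast
    obtain R where R: "\<And>v. v \<in> partition_polytope \<phi> l \<Longrightarrow> norm v \<le> R"
      using bounded_partition_polytope[of \<rho> \<phi> l, OF \<rho>] unfolding bounded_iff by blast
    define D where "D = \<bar>R\<bar> + norm x + 1"
    have "D > 0" unfolding D_def using norm_ge_zero[of x] by linarith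
    have "ball (- axis e (1 :: real)) (- x $ e / D) \<subseteq> U"
    proof
      fix c assume "c \<in> ball (- axis e (1 :: real)) (- x $ e / D)"
      then have c: "norm (c + axis e 1) < - x $ e / D"
        by (simp add: dist_norm norm_minus_commute)
      have "c \<bullet> v < c \<bullet> x" if v: "v \<in> partition_polytope \<phi> l" for v
      proof -
        have "\<bar>(c + axis e 1) \<bullet> (v - x)\<bar> \<le> norm (c + axis e 1) * norm (v - x)"
          by (rule Cauchy_Schwarz_ineq2)
        also have "norm (v - x) \<le> D"
          unfolding D_def using R[OF v] norm_triangle_ineq4[of v x] by linarith
        then have "norm (c + axis e 1) * norm (v - x) \<le> norm (c + axis e 1) * D"
          by (simp add: mult_left_mono)
        also have "\<dots> < - x $ e" using c \<open>D > 0\<close> by (simp add: field_simps)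
        finally have "(c + axis e 1) \<bullet> (v - x) < - x $ e" by linarith
        moreover have "axis e 1 \<bullet> (v - x) = v $ e - x $ e" by (simp add: inner_axis')
        moreover have "0 \<le> v $ e" using v by (simp add: partition_polytope_def)
        ultimately show ?thesis by (simp add: inner_add_left inner_diff_right)
      qed
      then show "c \<in> U" unfolding U_def using False by simp
    qed
    moreover have "- axis e (1 :: real) \<in> ball (- axis e (1 :: real)) (- x $ e / D)"
      using divide_pos_pos[of "- x $ e" D] e \<open>D > 0\<close> by simp
    ultimately show ?thesis using open_ball interiorI by blast
  qed (simp add: U_def)
  then obtain c where "c \<in> U" and c: "generic_cost \<phi> l c"
    using generic_cost_dense[OF gen reg open_interior] interior_subset by (metis subsetD)
  define VS where "VS = vertex_sets \<phi> l"
  have "\<forall>b\<in>VS. \<exists>y. \<forall>i\<in>b. y \<bullet> \<phi> i = c $ i"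
    unfolding VS_def using vertex_set_multiplier_exists by blast
  then obtain Y where Y: "\<And>b i. b \<in> VS \<Longrightarrow> i \<in> b \<Longrightarrow> Y b \<bullet> \<phi> i = c $ i" by metis
  have Y_unique: "y = Y b" if "b \<in> VS" "\<forall>i\<in>b. y \<bullet> \<phi> i = c $ i" for b y
    using multiplier_unique[OF vertex_set_span(1)[OF gen reg], of b y c "Y b"] that Y
    unfolding VS_def by blast
  define Up where "Up b = {j. Y b \<bullet> \<phi> j < c $ j}" for b
  define F where "F b = {I. b \<union> N \<subseteq> I \<and> I \<subseteq> b \<union> Up b}" for b
  \<comment> \<open>\<open>F b\<close> collects the sets \<open>I \<supseteq> N\<close> whose optimal basis is \<open>b\<close>.\<close>
  have "{I. l \<in> cone_of \<phi> I \<and> N \<subseteq> I} = (\<Union>b\<in>VS. F b)"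
  proof (intro equalityI subsetI)
    fix I assume I: "I \<in> {I. l \<in> cone_of \<phi> I \<and> N \<subseteq> I}"
    then have "l \<in> cone_of \<phi> I" by blast
    then obtain b y where b: "b \<in> vertex_sets \<phi> l" "b \<subseteq> I" "\<forall>i\<in>b. y \<bullet> \<phi> i = c $ i"
        "\<forall>j\<in>I - b. y \<bullet> \<phi> j < c $ j"
      using optimal_vertex_set_exists[of \<phi> \<rho> l c I, OF gen \<rho> reg c] by metis
    then have "b \<in> VS" "y = Y b" using Y_unique VS_def by auto
    then have "I \<in> F b" unfolding F_def Up_def using b I by blast
    then show "I \<in> (\<Union>b\<in>VS. F b)" using \<open>b \<in> VS\<close> by blast
  next
    fix I assume "I \<in> (\<Union>b\<in>VS. F b)"
    then obtain b where b: "b \<in> VS" "b \<subseteq> I" "N \<subseteq> I" unfolding F_def by blast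
    then have "l \<in> cone_of \<phi> b" unfolding VS_def vertex_sets_def by blast
    then show "I \<in> {I. l \<in> cone_of \<phi> I \<and> N \<subseteq> I}" using b cone_of_mono[OF b(2)] by blast
  qed
  moreover have "(\<Sum>I\<in>(\<Union>b\<in>VS. F b). (- 1) ^ card I :: real) = (\<Sum>b\<in>VS. \<Sum>I\<in>F b. (- 1) ^ card I)"
  proof (rule sum.UNION_disjoint)
    show "\<forall>b\<in>VS. \<forall>b'\<in>VS. b \<noteq> b' \<longrightarrow> F b \<inter> F b' = {}"
    proof (intro ballI impI, rule ccontr)
      fix b b' assume bb': "b \<in> VS" "b' \<in> VS" "b \<noteq> b'" "F b \<inter> F b' \<noteq> {}"
      then obtain I where I: "b \<subseteq> I" "I \<subseteq> b \<union> Up b" "b' \<subseteq> I" "I \<subseteq> b' \<union> Up b'"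
        unfolding F_def by blast
      have "b = b'"
        by (rule optimal_vertex_set_unique[OF gen reg, of b I "Y b" c b' "Y b'"])
          (use bb'(1,2) I Y in \<open>auto simp: VS_def Up_def\<close>)
      then show False using bb'(3) by blast
    qed
  qed auto
  moreover have "(\<Sum>I\<in>F b. (- 1) ^ card I :: real) =
      (if b \<union> N = b \<union> Up b then (- 1) ^ card (b \<union> Up b) else 0)" for b
    unfolding F_def by (rule sum_alternating_interval) simp
  ultimately have total: "(\<Sum>I | l \<in> cone_of \<phi> I \<and> N \<subseteq> I. (- 1) ^ card I :: real) =
      (\<Sum>b\<in>VS. if b \<union> N = b \<union> Up b then (- 1) ^ card (b \<union> Up b) else 0)"
    by simp
  show ?thesis
  proof (cases "N = {}")
    case True
    \<comment> \<open>Only the vertex that maximises \<open>c\<close> contributes.\<close>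
    have "l \<in> cone_of \<phi> UNIV"
      unfolding cone_of_iff using x True by (intro exI[of _ x]) (auto simp: N_def not_less)
    then obtain b y where b: "b \<in> vertex_sets \<phi> l" "\<forall>i\<in>b. y \<bullet> \<phi> i = (- c) $ i"
        "\<forall>j\<in>UNIV - b. y \<bullet> \<phi> j < (- c) $ j"
      using optimal_vertex_set_exists[of \<phi> \<rho> l "- c" UNIV, OF gen \<rho> reg generic_cost_uminus[OF c]]
      by metis
    have "- y = Y b" using Y_unique[of b "- y"] b by (simp add: VS_def)
    then have "Y b \<bullet> \<phi> j = - (y \<bullet> \<phi> j)" for j by (metis inner_minus_left)
    then have "j \<notin> Up b" if "j \<notin> b" for j
      using bspec[OF b(3), of j] that by (simp add: Up_def)
    then have "Up b \<subseteq> b" by blast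
    have only: "b' = b" if b': "b' \<in> VS" "b' = b' \<union> Up b'" for b'
    proof (rule optimal_vertex_set_unique[OF gen reg, of b' UNIV "- Y b'" "- c" b y])
      show "\<forall>j\<in>UNIV - b'. (- Y b') \<bullet> \<phi> j < (- c) $ j"
      proof
        fix j assume "j \<in> UNIV - b'"
        then have j: "j \<notin> b'" "j \<notin> Up b'" using b'(2) by auto
        then have "Y b' \<bullet> \<phi> j \<noteq> c $ j"
          using c b'(1) Y[OF b'(1)] unfolding generic_cost_def VS_def by blast
        then show "(- Y b') \<bullet> \<phi> j < (- c) $ j" using j(2) by (simp add: Up_def)
      qed
    qed (use b b'(1) Y[OF b'(1)] in \<open>auto simp: VS_def\<close>)
    have "(\<Sum>b'\<in>VS. if b' \<union> N = b' \<union> Up b' then (- 1) ^ card (b' \<union> Up b') else 0 :: real) =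
        (\<Sum>b'\<in>VS. if b' = b then (- 1) ^ card b else 0)"
    proof (rule sum.cong)
      fix b' assume "b' \<in> VS"
      then have "b' \<union> N = b' \<union> Up b' \<longleftrightarrow> b' = b"
        using only[of b'] \<open>Up b \<subseteq> b\<close> True by auto
      moreover have "b \<union> Up b = b" using \<open>Up b \<subseteq> b\<close> by blast
      ultimately show "(if b' \<union> N = b' \<union> Up b' then (- 1) ^ card (b' \<union> Up b') else 0 :: real) =
          (if b' = b then (- 1) ^ card b else 0)" by auto
    qed simp
    also have "\<dots> = (- 1) ^ DIM('a)"
      using b(1) vertex_set_span(2)[OF gen reg b(1)] by (simp add: VS_def)
    finally show ?thesis using total True unfolding N_def by simp
  next
    case False
    \<comment> \<open>A contributing basis would have a vertex at which \<open>c\<close> is at least as large as at \<open>x\<close>.\<close>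
    have none: "b \<union> N \<noteq> b \<union> Up b" if b: "b \<in> VS" for b
    proof
      assume eq: "b \<union> N = b \<union> Up b"
      obtain v where v: "combination \<phi> v = l" "\<forall>i\<in>b. 0 < v $ i" "\<forall>i. i \<notin> b \<longrightarrow> v $ i = 0"
        using vertex_set_point[OF gen reg] b unfolding VS_def by metis
      have "v \<in> partition_polytope \<phi> l"
        unfolding partition_polytope_def using v
        by (auto simp: affine_fibre_iff) (metis less_imp_le order_refl)
      then have "c \<bullet> v < c \<bullet> x" using \<open>c \<in> U\<close> False unfolding U_def by simp
      have "v $ i * (c $ i - Y b \<bullet> \<phi> i) = 0" for i
        using v(3) Y[OF b] by (cases "i \<in> b") auto
      then have "(\<Sum>i\<in>UNIV. v $ i * (c $ i - Y b \<bullet> \<phi> i)) = 0" by (intro sum.neutral) blast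
      then have "c \<bullet> v = Y b \<bullet> l" using reduced_cost_sum[OF v(1), of c "Y b"] by simp
      have "x $ i * (c $ i - Y b \<bullet> \<phi> i) \<le> 0" for i
      proof -
        consider "i \<in> b" | "i \<notin> b" "i \<in> N" "i \<in> Up b" | "i \<notin> b" "i \<notin> N" "i \<notin> Up b" using eq by blast
        then show ?thesis
        proof cases
          case 1
          then show ?thesis using Y[OF b] by simp
        next
          case 2
          then show ?thesis by (intro mult_nonpos_nonneg) (auto simp: N_def Up_def)
        next
          case 3
          then show ?thesis by (intro mult_nonneg_nonpos) (auto simp: N_def Up_def)
        qed
      qed
      then have "(\<Sum>i\<in>UNIV. x $ i * (c $ i - Y b \<bullet> \<phi> i)) \<le> 0" by (intro sum_nonpos) blast
      then have "c \<bullet> x \<le> Y b \<bullet> l" using reduced_cost_sum[OF x, of c "Y b"] by simp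
      then show False using \<open>c \<bullet> v < c \<bullet> x\<close> \<open>c \<bullet> v = Y b \<bullet> l\<close> by simp
    qed
    then have "(\<Sum>b\<in>VS. if b \<union> N = b \<union> Up b then (- 1) ^ card (b \<union> Up b) else 0 :: real) = 0"
      by (intro sum.neutral) auto
    then show ?thesis using total False unfolding N_def by simp
  qed
qed

definition alternating_sum ::
    "('n::finite \<Rightarrow> 'a::euclidean_space) \<Rightarrow> 'a set \<Rightarrow> 'n set \<Rightarrow> real" where
  "alternating_sum \<phi> \<tau> N = (\<Sum>I | I \<in> generating_sets \<phi> \<tau> \<and> N \<subseteq> I. (- 1) ^ card I)"

lemma alternating_sum_own_tope:
  fixes \<phi> :: "'n::finite \<Rightarrow> 'a::euclidean_space"
  assumes gen: "span (range \<phi>) = UNIV" and \<rho>: "\<And>i. 0 < \<rho> \<bullet> \<phi> i"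
    and \<tau>: "\<tau> \<in> topes \<phi>" and x: "combination \<phi> x \<in> \<tau>"
  shows "alternating_sum \<phi> \<tau> {i. x $ i < 0} = (if {i. x $ i < 0} = {} then (- 1) ^ DIM('a) else 0)"
proof -
  have "combination \<phi> x \<notin> \<Union>(walls \<phi>)" using tope_avoids_walls[OF \<tau>] x by blast
  then show ?thesis
    using brianchon_gram_sum[of \<phi> \<rho> "combination \<phi> x" x, OF gen \<rho>]
    unfolding alternating_sum_def generating_sets_iff[OF gen \<tau> x] by simp
qed

lemma brianchon_gram_alternating_sum:
  fixes \<phi> :: "'n::finite \<Rightarrow> 'a::euclidean_space"
  shows "brianchon_gram \<phi> \<tau> x = (- 1) ^ DIM('a) * alternating_sum \<phi> \<tau> {i. x $ i < 0}"
proof -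
  have "(- 1) ^ (card I - DIM('a)) * (\<Prod>j\<in>-I. indicator {y. 0 \<le> y $ j} x) =
      (if {i. x $ i < 0} \<subseteq> I then (- 1) ^ DIM('a) * (- 1) ^ card I else 0 :: real)"
    if I: "I \<in> generating_sets \<phi> \<tau>" for I
  proof -
    have "DIM('a) = dim (\<phi> ` I)"
      using I dim_span[of "\<phi> ` I"] by (simp add: generating_sets_def)
    also have "\<dots> \<le> card I"
      using dim_le_card'[of "\<phi> ` I"] card_image_le[of I \<phi>] by simp
    finally have "(- 1 :: real) ^ (card I - DIM('a)) = (- 1) ^ DIM('a) * (- 1) ^ card I"
      by (simp add: power_add[symmetric] minus_one_power_iff)
    moreover have "(\<Prod>j\<in>-I. indicator {y. 0 \<le> y $ j} x :: real) = of_bool ({i. x $ i < 0} \<subseteq> I)"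
    proof (cases "{i. x $ i < 0} \<subseteq> I")
      case True
      then show ?thesis by (auto intro!: prod.neutral simp: indicator_def subset_iff not_less[symmetric])
    next
      case False
      then obtain j where "j \<in> - I" "x $ j < 0" by blast
      then show ?thesis using False
        by (auto intro!: prod_zero bexI[of _ j] simp: indicator_def)
    qed
    ultimately show ?thesis by simp
  qed
  then have "brianchon_gram \<phi> \<tau> x = (\<Sum>I\<in>generating_sets \<phi> \<tau>.
      if {i. x $ i < 0} \<subseteq> I then (- 1) ^ DIM('a) * (- 1) ^ card I else 0)"
    unfolding brianchon_gram_def by (rule sum.cong[OF refl])
  also have "\<dots> = (\<Sum>I | I \<in> generating_sets \<phi> \<tau> \<and> {i. x $ i < 0} \<subseteq> I. (- 1) ^ DIM('a) * (- 1) ^ card I)"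
    by (rule sum.mono_neutral_cong_right) auto
  finally show ?thesis by (simp add: alternating_sum_def sum_distrib_left)
qed

section \<open>Crossing a wall\<close>

text \<open>The local picture at a point \<open>\<mu>\<close> of the hyperplane orthogonal to \<open>a\<close> that lies on no other wall. The
  tope on the other side of the hyperplane is described by the same predicate with \<open>- a\<close>.\<close>

definition borders_wall_at ::
    "('n::finite \<Rightarrow> 'a::euclidean_space) \<Rightarrow> 'a \<Rightarrow> 'a \<Rightarrow> 'a set \<Rightarrow> bool" where
  "borders_wall_at \<phi> a \<mu> \<tau> \<longleftrightarrow> \<tau> \<in> topes \<phi> \<and> \<tau> \<subseteq> {y. 0 < a \<bullet> y} \<and> a \<bullet> \<mu> = 0 \<and>
     (\<forall>w\<in>walls \<phi>. \<mu> \<in> w \<longrightarrow> w = {y. a \<bullet> y = 0}) \<and>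
     (\<exists>e>0. ball \<mu> e \<inter> {y. 0 < a \<bullet> y} \<subseteq> \<tau>)"

text \<open>Topes are stable under positive scaling. This shows that the closures of two topes
  always meet.\<close>

lemma zero_in_closure_tope:
  assumes \<tau>: "\<tau> \<in> topes \<phi>"
  shows "0 \<in> closure \<tau>"
proof -
  obtain y where y: "y \<in> \<tau>" using \<tau>[unfolded topes_def] in_components_nonempty by blast
  define R where "R = (\<lambda>t. t *\<^sub>R y) ` {0<..}"
  have "R \<subseteq> - \<Union>(walls \<phi>)"
  proof
    fix z assume "z \<in> R"
    then obtain t where t: "0 < t" "z = t *\<^sub>R y" unfolding R_def by auto
    have "y \<in> w" if "z \<in> w" "w \<in> walls \<phi>" for w
    proof -
      have "inverse t *\<^sub>R z \<in> w" using subspace_scale[OF walls_subspace[OF that(2)] that(1)] .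
      then show ?thesis using t by simp
    qed
    then show "z \<in> - \<Union>(walls \<phi>)" using y tope_avoids_walls[OF \<tau>] by blast
  qed
  moreover have "connected R"
    unfolding R_def by (intro connected_continuous_image continuous_intros) simp
  moreover have "y \<in> R" unfolding R_def by (rule image_eqI[of _ _ 1]) auto
  ultimately have "R \<subseteq> \<tau>"
    using components_maximal[OF \<tau>[unfolded topes_def], of R] y by blast
  moreover have "0 \<in> closure R"
    unfolding closure_approachable
  proof (intro allI impI)
    fix e :: real assume "0 < e"
    define t where "t = e / (norm y + 1)"
    have "norm y + 1 > 0" by (simp add: add_nonneg_pos)
    then have "0 < t" "t * norm y < e" using \<open>0 < e\<close> by (auto simp: t_def field_simps)
    then show "\<exists>z\<in>R. dist z 0 < e"
      by (intro bexI[of _ "t *\<^sub>R y"]) (auto simp: R_def)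
  qed
  ultimately show ?thesis using closure_mono by blast
qed

text \<open>For \<open>\<mu>\<close> one can take any relative interior point of the intersection of the closures.\<close>

lemma adjacent_topes_border:
  fixes \<phi> :: "'n::finite \<Rightarrow> 'a::euclidean_space"
  assumes adj: "adjacent_topes \<phi> \<tau>\<^sub>1 \<tau>\<^sub>2"
  obtains a \<mu> where "span (closure \<tau>\<^sub>1 \<inter> closure \<tau>\<^sub>2) = {y. a \<bullet> y = 0}" "a \<noteq> 0"
    "borders_wall_at \<phi> a \<mu> \<tau>\<^sub>1" "borders_wall_at \<phi> (- a) \<mu> \<tau>\<^sub>2"
proof -
  define Q where "Q = closure \<tau>\<^sub>1 \<inter> closure \<tau>\<^sub>2"
  define H where "H = span Q"
  have \<tau>: "\<tau>\<^sub>1 \<in> topes \<phi>" "\<tau>\<^sub>2 \<in> topes \<phi>" and H: "H \<in> walls \<phi>" "Q \<subseteq> H"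
    using adj unfolding adjacent_topes_def H_def Q_def by auto
  obtain a0 where a0: "a0 \<noteq> 0" "H = {y. a0 \<bullet> y = 0}" using walls_hyperplane[OF H(1)] by blast
  define a where "a = (if \<tau>\<^sub>1 \<subseteq> {y. 0 < a0 \<bullet> y} then a0 else - a0)"
  have "a \<noteq> 0" and Ha: "H = {y. a \<bullet> y = 0}" using a0 by (auto simp: a_def)
  have side1: "\<tau>\<^sub>1 \<subseteq> {y. 0 < a \<bullet> y}"
    using tope_hyperplane_side[OF \<tau>(1) H(1)[unfolded a0(2)]] by (auto simp: a_def)
  have "convex Q" unfolding Q_def using \<tau> convex_tope convex_closure convex_Int by metis
  moreover have "Q \<noteq> {}" unfolding Q_def using \<tau> zero_in_closure_tope by blast
  ultimately obtain \<mu> where \<mu>: "\<mu> \<in> rel_interior Q" using rel_interior_eq_empty by blast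
  have "\<mu> \<in> Q" using \<mu> rel_interior_subset by blast
  \<comment> \<open>\<open>Q\<close> lies on one side of every wall, so a wall through a relative interior point contains it.\<close>
  have only: "w = H" if w: "w \<in> walls \<phi>" "\<mu> \<in> w" for w
  proof -
    obtain b0 where b0: "w = {y. b0 \<bullet> y = 0}" using walls_hyperplane[OF w(1)] by blast
    define b where "b = (if \<tau>\<^sub>1 \<subseteq> {y. 0 < b0 \<bullet> y} then b0 else - b0)"
    have b: "w = {y. b \<bullet> y = 0}" using b0 by (auto simp: b_def)
    have "\<tau>\<^sub>1 \<subseteq> {y. 0 < b \<bullet> y}"
      using tope_hyperplane_side[OF \<tau>(1) w(1)[unfolded b0]] by (auto simp: b_def)
    then have "\<tau>\<^sub>1 \<subseteq> {y. b \<bullet> y \<ge> 0}" by (auto simp: subset_iff less_imp_le)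
    then have "closure \<tau>\<^sub>1 \<subseteq> {y. b \<bullet> y \<ge> 0}" using closed_halfspace_ge by (rule closure_minimal)
    then have Q0: "0 \<le> b \<bullet> y" if "y \<in> Q" for y using that unfolding Q_def by blast
    have "b \<bullet> y = 0" if y: "y \<in> Q" for y
    proof -
      obtain e where e: "1 < e" "(1 - e) *\<^sub>R y + e *\<^sub>R \<mu> \<in> Q"
        using convex_rel_interior_iff[OF \<open>convex Q\<close> \<open>Q \<noteq> {}\<close>] \<mu> y by blast
      have "0 \<le> (1 - e) * (b \<bullet> y)"
        using Q0[OF e(2)] w(2) b by (simp add: inner_add_right)
      then have "b \<bullet> y \<le> 0" using e(1) by (simp add: zero_le_mult_iff)
      then show ?thesis using Q0[OF y] by simp
    qed
    then have "Q \<subseteq> w" using b by blast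
    then have "H \<subseteq> w" unfolding H_def using walls_subspace[OF w(1)] by (rule span_minimal)
    then show ?thesis using walls_eq_if_subset[OF H(1) w(1)] by simp
  qed
  have "finite (walls \<phi> - {H})" using finite_walls by blast
  then have "closed (\<Union>(walls \<phi> - {H}))"
    by (rule closed_Union) (use closed_subspace walls_subspace in blast)
  then have "open (- \<Union>(walls \<phi> - {H}))" by (rule open_Compl)
  moreover have "\<mu> \<in> - \<Union>(walls \<phi> - {H})" using only by blast
  ultimately obtain e where e: "0 < e" "ball \<mu> e \<subseteq> - \<Union>(walls \<phi> - {H})"
    using open_contains_ball by metis
  have half: "ball \<mu> e \<inter> {y. 0 < b \<bullet> y} \<subseteq> \<tau>"
    if \<tau>: "\<tau> \<in> topes \<phi>" and b: "\<tau> \<subseteq> {y. 0 < b \<bullet> y}" "H = {y. b \<bullet> y = 0}" and "\<mu> \<in> closure \<tau>" for b \<tau>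
  proof (rule components_maximal[OF \<tau>[unfolded topes_def]])
    show "connected (ball \<mu> e \<inter> {y. 0 < b \<bullet> y})"
      using convex_Int[OF convex_ball convex_halfspace_gt] by (rule convex_connected)
    show "ball \<mu> e \<inter> {y. 0 < b \<bullet> y} \<subseteq> - \<Union>(walls \<phi>)"
    proof
      fix y assume y: "y \<in> ball \<mu> e \<inter> {y. 0 < b \<bullet> y}"
      then have "y \<notin> H" unfolding b(2) by auto
      then show "y \<in> - \<Union>(walls \<phi>)" using y e(2) by blast
    qed
    obtain y where "y \<in> \<tau>" "dist y \<mu> < e"
      using \<open>\<mu> \<in> closure \<tau>\<close> e(1) unfolding closure_approachable by blast
    then show "\<tau> \<inter> (ball \<mu> e \<inter> {y. 0 < b \<bullet> y}) \<noteq> {}"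
      using b(1) by (auto simp: dist_commute)
  qed
  have \<mu>_cl: "\<mu> \<in> closure \<tau>\<^sub>1" "\<mu> \<in> closure \<tau>\<^sub>2" using \<open>\<mu> \<in> Q\<close> by (auto simp: Q_def)
  have half1: "ball \<mu> e \<inter> {y. 0 < a \<bullet> y} \<subseteq> \<tau>\<^sub>1" using half[OF \<tau>(1) side1 Ha \<mu>_cl(1)] .
  have side2: "\<tau>\<^sub>2 \<subseteq> {y. 0 < (- a) \<bullet> y}"
  proof (rule ccontr)
    assume "\<not> ?thesis"
    then have "\<tau>\<^sub>2 \<subseteq> {y. 0 < a \<bullet> y}"
      using tope_hyperplane_side[OF \<tau>(2) H(1)[unfolded Ha]] by auto
    then have half2: "ball \<mu> e \<inter> {y. 0 < a \<bullet> y} \<subseteq> \<tau>\<^sub>2" using half[OF \<tau>(2) _ Ha \<mu>_cl(2)] by blast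
    obtain y where y: "y \<in> \<tau>\<^sub>1" "dist y \<mu> < e"
      using \<mu>_cl(1) e(1) unfolding closure_approachable by blast
    then have "y \<in> ball \<mu> e \<inter> {y. 0 < a \<bullet> y}" using side1 by (auto simp: dist_commute)
    then have "y \<in> \<tau>\<^sub>2" using half2 by blast
    then have "\<tau>\<^sub>1 = \<tau>\<^sub>2"
      using y(1) components_nonoverlap[OF \<tau>(1)[unfolded topes_def] \<tau>(2)[unfolded topes_def]] by blast
    then have "y \<in> H" using y(1) H(2) closure_subset unfolding Q_def by blast
    then show False using y(1) tope_avoids_walls[OF \<tau>(1)] H(1) by blast
  qed
  have Ha': "H = {y. (- a) \<bullet> y = 0}" using Ha by simp
  have half2: "ball \<mu> e \<inter> {y. 0 < (- a) \<bullet> y} \<subseteq> \<tau>\<^sub>2" using half[OF \<tau>(2) side2 Ha' \<mu>_cl(2)] .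
  have "a \<bullet> \<mu> = 0" using \<open>\<mu> \<in> Q\<close> H(2) Ha by blast
  then have "borders_wall_at \<phi> a \<mu> \<tau>\<^sub>1" "borders_wall_at \<phi> (- a) \<mu> \<tau>\<^sub>2"
    unfolding borders_wall_at_def using \<tau> side1 side2 half1 half2 e(1) only Ha Ha' by auto
  then show ?thesis using that[of a \<mu>] Ha \<open>a \<noteq> 0\<close> unfolding H_def Q_def by blast
qed

text \<open>If \<open>\<mu>\<close> is in the cone of the vectors of \<open>I\<close> on the wall, then adding a small multiple of some \<open>\<phi> i\<close> on the
  side of \<open>\<tau>\<close> leads into \<open>\<tau>\<close>, and without such an \<open>i\<close> the cone stays on the other side. If not, then \<open>\<mu>\<close> is
  either outside the closed cone of \<open>I\<close> or an interior point of it, because vectors that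
  do not span lie in a wall and this wall could only be the given one.\<close>

lemma generating_sets_at_wall:
  fixes \<phi> :: "'n::finite \<Rightarrow> 'a::euclidean_space"
  assumes gen: "span (range \<phi>) = UNIV" and bw: "borders_wall_at \<phi> a \<mu> \<tau>"
  shows "I \<in> generating_sets \<phi> \<tau> \<longleftrightarrow>
    (if \<mu> \<in> cone_of \<phi> (I \<inter> {i. a \<bullet> \<phi> i = 0}) then \<exists>i\<in>I. 0 < a \<bullet> \<phi> i else \<mu> \<in> cone_of \<phi> I)"
proof -
  have \<tau>: "\<tau> \<in> topes \<phi>" "\<tau> \<subseteq> {y. 0 < a \<bullet> y}" and a\<mu>: "a \<bullet> \<mu> = 0"
    and only: "\<And>w. w \<in> walls \<phi> \<Longrightarrow> \<mu> \<in> w \<Longrightarrow> w = {y. a \<bullet> y = 0}"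
    using bw unfolding borders_wall_at_def by auto
  obtain e where e: "0 < e" "ball \<mu> e \<inter> {y. 0 < a \<bullet> y} \<subseteq> \<tau>"
    using bw unfolding borders_wall_at_def by blast
  obtain y0 where y0: "y0 \<in> \<tau>" using \<tau>(1)[unfolded topes_def] in_components_nonempty by blast
  have near: "\<exists>s>0. \<mu> + s *\<^sub>R v \<in> \<tau> \<and> dist (\<mu> + s *\<^sub>R v) \<mu> < d" if "0 < a \<bullet> v" "0 < d" for v d
  proof -
    define m where "m = min d e"
    define s where "s = m / (norm v + 1)"
    have "m > 0" using e(1) that(2) by (simp add: m_def)
    moreover have "norm v + 1 > 0" by (simp add: add_nonneg_pos)
    ultimately have "0 < s" "s * norm v < m" by (auto simp: s_def field_simps)
    then have s: "0 < s" "dist (\<mu> + s *\<^sub>R v) \<mu> < d" "\<mu> + s *\<^sub>R v \<in> ball \<mu> e"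
      by (auto simp: dist_norm m_def)
    moreover have "0 < a \<bullet> (\<mu> + s *\<^sub>R v)" using a\<mu> s(1) that(1) by (simp add: inner_add_right)
    ultimately show ?thesis using e(2) by blast
  qed
  have a_pos: "0 < a \<bullet> y0" using y0 \<tau>(2) by blast
  show ?thesis
  proof (cases "\<mu> \<in> cone_of \<phi> (I \<inter> {i. a \<bullet> \<phi> i = 0})")
    case True
    have "I \<in> generating_sets \<phi> \<tau>" if i: "i \<in> I" "0 < a \<bullet> \<phi> i" for i
    proof -
      obtain s where s: "0 < s" "\<mu> + s *\<^sub>R \<phi> i \<in> \<tau>" using near[OF i(2), of 1] by auto
      obtain x where x: "combination \<phi> x = \<mu>" "\<forall>k. 0 \<le> x $ k" "\<forall>k. k \<notin> I \<longrightarrow> x $ k = 0"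
        using True unfolding cone_of_iff by blast
      then have "\<mu> + s *\<^sub>R \<phi> i \<in> cone_of \<phi> I"
        unfolding cone_of_iff using i(1) s(1)
        by (intro exI[of _ "x + axis i s"]) (auto simp: combination_simps axis_component)
      then show ?thesis using generating_sets_iff[OF gen \<tau>(1) s(2)] by simp
    qed
    moreover have "\<exists>i\<in>I. 0 < a \<bullet> \<phi> i" if "I \<in> generating_sets \<phi> \<tau>"
    proof (rule ccontr)
      assume neg: "\<not> ?thesis"
      have "y0 \<in> cone_of \<phi> I" using that generating_sets_iff[OF gen \<tau>(1) y0] by simp
      then show False using cone_of_nonpos[of y0 \<phi> I a] neg a_pos by (auto simp: not_less)
    qed
    ultimately show ?thesis using True by auto
  next
    case False
    have "\<mu> \<in> cone_of \<phi> I" if "I \<in> generating_sets \<phi> \<tau>"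
    proof -
      have "\<mu> \<in> closure \<tau>"
        unfolding closure_approachable using near[OF a_pos] by blast
      moreover have "closure \<tau> \<subseteq> cone_of \<phi> I"
        using that closed_cone_of by (intro closure_minimal) (auto simp: generating_sets_def)
      ultimately show ?thesis by blast
    qed
    moreover have "I \<in> generating_sets \<phi> \<tau>" if "\<mu> \<in> cone_of \<phi> I"
    proof -
      obtain J x where J: "J \<subseteq> I" "combination \<phi> x = \<mu>" "\<forall>i\<in>J. 0 < x $ i" "\<forall>i. i \<notin> J \<longrightarrow> x $ i = 0"
        using cone_of_supportE[OF \<open>\<mu> \<in> cone_of \<phi> I\<close>] .
      have "span (\<phi> ` J) = UNIV"
      proof (rule ccontr)
        assume "span (\<phi> ` J) \<noteq> UNIV"
        then obtain w where w: "w \<in> walls \<phi>" "\<phi> ` J \<subseteq> w" using wall_containing[OF gen] by metis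
        have "\<mu> \<in> span (\<phi> ` J)" unfolding span_image_combination using J(2,4) by blast
        then have "\<mu> \<in> w" using span_minimal[OF w(2) walls_subspace[OF w(1)]] by blast
        then have "J \<subseteq> {i. a \<bullet> \<phi> i = 0}" using only[OF w(1)] w(2) by blast
        then have "\<mu> \<in> cone_of \<phi> (I \<inter> {i. a \<bullet> \<phi> i = 0})"
          unfolding cone_of_iff using J
          by (intro exI[of _ x]) (auto, metis less_imp_le order_refl)
        then show False using False by blast
      qed
      then have "\<mu> \<in> interior (cone_of \<phi> I)" using interior_cone_of[of \<phi> J I x] J by simp
      then obtain d where d: "0 < d" "ball \<mu> d \<subseteq> cone_of \<phi> I" unfolding mem_interior by blast
      obtain s where "\<mu> + s *\<^sub>R y0 \<in> \<tau>" "dist (\<mu> + s *\<^sub>R y0) \<mu> < d"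
        using near[OF a_pos d(1)] by blast
      then show ?thesis
        using generating_sets_iff[OF gen \<tau>(1), of "\<mu> + s *\<^sub>R y0" I] d(2)
        by (auto simp: dist_commute subset_iff)
    qed
    ultimately show ?thesis using False by auto
  qed
qed

text \<open>The contribution of the vectors on the wall: with \<open>B\<close> the set of their indices, this is the
  alternating sum for these vectors inside the wall, taken at the tope of \<open>\<mu>\<close>. It is not evaluated
  inside the wall but by means of a second crossing of it.\<close>

definition wall_sum ::
    "('n::finite \<Rightarrow> 'a::euclidean_space) \<Rightarrow> 'n set \<Rightarrow> 'a \<Rightarrow> 'n set \<Rightarrow> real" where
  "wall_sum \<phi> B \<mu> M = (\<Sum>K | M \<subseteq> K \<and> K \<subseteq> B \<and> \<mu> \<in> cone_of \<phi> K. (- 1) ^ card K)"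

theorem alternating_sum_wall_crossing:
  fixes \<phi> :: "'n::finite \<Rightarrow> 'a::euclidean_space"
  assumes gen: "span (range \<phi>) = UNIV"
    and bw: "borders_wall_at \<phi> a \<mu> \<tau>\<^sub>1" "borders_wall_at \<phi> (- a) \<mu> \<tau>\<^sub>2"
    and A: "A = {i. 0 < a \<bullet> \<phi> i}" and B: "B = {i. a \<bullet> \<phi> i = 0}" and C: "C = {i. a \<bullet> \<phi> i < 0}"
  shows "alternating_sum \<phi> \<tau>\<^sub>1 N - alternating_sum \<phi> \<tau>\<^sub>2 N =
    wall_sum \<phi> B \<mu> (N \<inter> B) *
      ((if N - B = A then (- 1) ^ card A else 0) - (if N - B = C then (- 1) ^ card C else 0))"
proof -
  have gen1: "I \<in> generating_sets \<phi> \<tau>\<^sub>1 \<longleftrightarrow>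
      (if \<mu> \<in> cone_of \<phi> (I \<inter> B) then \<exists>i\<in>I - B. i \<in> A else \<mu> \<in> cone_of \<phi> I)" for I
    using generating_sets_at_wall[OF gen bw(1), of I] unfolding A B by auto
  have gen2: "I \<in> generating_sets \<phi> \<tau>\<^sub>2 \<longleftrightarrow>
      (if \<mu> \<in> cone_of \<phi> (I \<inter> B) then \<exists>i\<in>I - B. i \<in> C else \<mu> \<in> cone_of \<phi> I)" for I
    using generating_sets_at_wall[OF gen bw(2), of I] unfolding B C by auto
  have as_sum: "alternating_sum \<phi> \<tau> N =
      (\<Sum>I | N \<subseteq> I. (- 1) ^ card I * of_bool (I \<in> generating_sets \<phi> \<tau>))" for \<tau>
    unfolding alternating_sum_def by (rule sum.mono_neutral_cong_left) auto
  have "alternating_sum \<phi> \<tau>\<^sub>1 N - alternating_sum \<phi> \<tau>\<^sub>2 N = (\<Sum>I | N \<subseteq> I.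
      ((- 1) ^ card (I \<inter> B) * of_bool (\<mu> \<in> cone_of \<phi> (I \<inter> B))) *
      ((- 1) ^ card (I - B) * (of_bool (\<exists>i\<in>I - B. i \<in> A) - of_bool (\<exists>i\<in>I - B. i \<in> C))))"
    unfolding as_sum sum_subtractf[symmetric]
  proof (rule sum.cong)
    fix I
    have "card I = card (I \<inter> B) + card (I - B)" using card_Int_Diff[of I B] by simp
    then have "(- 1 :: real) ^ card I = (- 1) ^ card (I \<inter> B) * (- 1) ^ card (I - B)"
      by (simp add: power_add)
    then show "(- 1) ^ card I * of_bool (I \<in> generating_sets \<phi> \<tau>\<^sub>1) -
        (- 1) ^ card I * of_bool (I \<in> generating_sets \<phi> \<tau>\<^sub>2) =
      ((- 1) ^ card (I \<inter> B) * of_bool (\<mu> \<in> cone_of \<phi> (I \<inter> B))) *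
      ((- 1 :: real) ^ card (I - B) * (of_bool (\<exists>i\<in>I - B. i \<in> A) - of_bool (\<exists>i\<in>I - B. i \<in> C)))"
      unfolding gen1 gen2 by (cases "\<mu> \<in> cone_of \<phi> (I \<inter> B)") (simp_all add: right_diff_distrib)
  qed simp
  also have "\<dots> = (\<Sum>K | N \<inter> B \<subseteq> K \<and> K \<subseteq> B. (- 1) ^ card K * of_bool (\<mu> \<in> cone_of \<phi> K)) *
      (\<Sum>L | N - B \<subseteq> L \<and> L \<subseteq> - B.
        (- 1) ^ card L * (of_bool (\<exists>i\<in>L. i \<in> A) - of_bool (\<exists>i\<in>L. i \<in> C)))"
    by (rule sum_superset_split)
  also have "(\<Sum>K | N \<inter> B \<subseteq> K \<and> K \<subseteq> B. (- 1) ^ card K * of_bool (\<mu> \<in> cone_of \<phi> K)) =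
      wall_sum \<phi> B \<mu> (N \<inter> B)"
    unfolding wall_sum_def by (rule sum.mono_neutral_cong_right) auto
  also have "(\<Sum>L | N - B \<subseteq> L \<and> L \<subseteq> - B.
        (- 1) ^ card L * (of_bool (\<exists>i\<in>L. i \<in> A) - of_bool (\<exists>i\<in>L. i \<in> C)) :: real) =
      (if N - B = A then (- 1) ^ card A else 0) - (if N - B = C then (- 1) ^ card C else 0)"
    by (rule alternating_sum_one_sided) (auto simp: A B C)
  finally show ?thesis .
qed

section \<open>Flipping the vectors on one side of the wall\<close>

definition flip :: "'n set \<Rightarrow> ('n \<Rightarrow> 'a::euclidean_space) \<Rightarrow> 'n \<Rightarrow> 'a" where
  "flip A \<phi> i = (if i \<in> A then - \<phi> i else \<phi> i)"

lemma span_flip: "span (flip A \<phi> ` J) = span (\<phi> ` J)"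
proof -
  have "flip A \<phi> j \<in> span (\<phi> ` J)" "\<phi> j \<in> span (flip A \<phi> ` J)" if "j \<in> J" for j
  proof -
    show "flip A \<phi> j \<in> span (\<phi> ` J)"
      using that by (auto simp: flip_def intro: span_neg span_base)
    have "flip A \<phi> j \<in> span (flip A \<phi> ` J)" using that by (auto intro: span_base)
    then show "\<phi> j \<in> span (flip A \<phi> ` J)"
      using span_neg[of "flip A \<phi> j"] by (auto simp: flip_def split: if_splits)
  qed
  then show ?thesis unfolding span_eq by blast
qed

lemma walls_flip: "walls (flip A \<phi>) = walls \<phi>"
  for \<phi> :: "'n::finite \<Rightarrow> 'a::euclidean_space"
proof -
  have "dim (flip A \<phi> ` J) = dim (\<phi> ` J)" for J
    using span_flip dim_span by metis
  then have "w \<in> walls (flip A \<phi>) \<longleftrightarrow> w \<in> walls \<phi>" for w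
    unfolding walls_iff span_flip by simp
  then show ?thesis by blast
qed

text \<open>Flipping preserves the spans of subsets, hence the walls and the topes.\<close>

lemma borders_wall_at_flip: "borders_wall_at (flip A \<phi>) a \<mu> \<tau> = borders_wall_at \<phi> a \<mu> \<tau>"
  unfolding borders_wall_at_def topes_def walls_flip ..

lemma wall_sum_flip:
  fixes \<phi> :: "'n::finite \<Rightarrow> 'a::euclidean_space"
  assumes "A \<inter> B = {}"
  shows "wall_sum (flip A \<phi>) B \<mu> M = wall_sum \<phi> B \<mu> M"
proof -
  have "cone_of (flip A \<phi>) K = cone_of \<phi> K" if "K \<subseteq> B" for K
  proof -
    have "(\<Sum>i\<in>K. t i *\<^sub>R flip A \<phi> i) = (\<Sum>i\<in>K. t i *\<^sub>R \<phi> i)" for t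
      by (rule sum.cong) (use that assms in \<open>auto simp: flip_def\<close>)
    then show ?thesis unfolding cone_of_def by simp
  qed
  then show ?thesis unfolding wall_sum_def by (metis (mono_tags, lifting))
qed

text \<open>Subtracting a large multiple of \<open>a\<close> from \<open>\<rho>\<close> keeps it unchanged on the vectors of the wall and makes it
  positive on the others, which after the flip are all on the negative side of \<open>a\<close>.\<close>

lemma flip_positive_functional:
  fixes \<phi> :: "'n::finite \<Rightarrow> 'a::euclidean_space"
  assumes \<rho>: "\<And>i. 0 < \<rho> \<bullet> \<phi> i"
  obtains \<rho>' where "\<And>i. 0 < \<rho>' \<bullet> flip {i. 0 < a \<bullet> \<phi> i} \<phi> i"
proof -
  \<comment> \<open>A summand with \<open>a \<bullet> \<phi> i = 0\<close> is \<open>0\<close>, by the convention for division by \<open>0\<close>.\<close>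
  define M where "M = 1 + (\<Sum>i\<in>UNIV. \<bar>\<rho> \<bullet> \<phi> i\<bar> / \<bar>a \<bullet> \<phi> i\<bar>)"
  have "0 < (\<rho> - M *\<^sub>R a) \<bullet> flip {i. 0 < a \<bullet> \<phi> i} \<phi> i" for i
  proof (cases "a \<bullet> \<phi> i = 0")
    case True
    then show ?thesis using \<rho>[of i] by (simp add: flip_def inner_diff_left)
  next
    case False
    have "\<bar>\<rho> \<bullet> \<phi> i\<bar> / \<bar>a \<bullet> \<phi> i\<bar> \<le> (\<Sum>i\<in>UNIV. \<bar>\<rho> \<bullet> \<phi> i\<bar> / \<bar>a \<bullet> \<phi> i\<bar>)"
      by (rule member_le_sum) auto
    then have "\<bar>\<rho> \<bullet> \<phi> i\<bar> / \<bar>a \<bullet> \<phi> i\<bar> < M" by (simp add: M_def)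
    then have "\<bar>\<rho> \<bullet> \<phi> i\<bar> < M * \<bar>a \<bullet> \<phi> i\<bar>" using False by (simp add: pos_divide_less_eq)
    then show ?thesis using False by (auto simp: flip_def inner_diff_left abs_if split: if_splits)
  qed
  then show ?thesis using that by blast
qed

text \<open>The value is obtained by crossing the same wall for the flipped vectors, for which the flipped
  point has negative set \<open>{i. x $ i < 0} \<inter> B\<close> and for which \<open>\<tau>\<^sub>1\<close> lies outside the cone.\<close>

lemma wall_sum_flipped_point:
  fixes \<phi> :: "'n::finite \<Rightarrow> 'a::euclidean_space"
  assumes gen: "span (range \<phi>) = UNIV" and \<rho>: "\<And>i. 0 < \<rho> \<bullet> \<phi> i" and "a \<noteq> 0"
    and bw: "borders_wall_at \<phi> a \<mu> \<tau>\<^sub>1" "borders_wall_at \<phi> (- a) \<mu> \<tau>\<^sub>2"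
    and A: "A = {i. 0 < a \<bullet> \<phi> i}" and B: "B = {i. a \<bullet> \<phi> i = 0}"
    and x: "combination \<phi> x \<in> \<tau>\<^sub>2" and N: "{i. x $ i < 0} - B = A"
  shows "wall_sum \<phi> B \<mu> ({i. x $ i < 0} \<inter> B) =
    - (if {i. x $ i < 0} \<inter> B = {} then (- 1) ^ DIM('a) else 0)"
proof -
  define \<psi> where "\<psi> = flip A \<phi>"
  define x' where "x' = (\<chi> i. if i \<in> A then - x $ i else x $ i)"
  define N' where "N' = {i. x' $ i < 0}"
  have gen': "span (range \<psi>) = UNIV" using gen unfolding \<psi>_def span_flip .
  have "\<exists>\<rho>'. \<forall>i. 0 < \<rho>' \<bullet> \<psi> i"
    using flip_positive_functional[of \<rho> \<phi> a, OF \<rho>] unfolding \<psi>_def A by metis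
  then obtain \<rho>' where \<rho>': "\<And>i. 0 < \<rho>' \<bullet> \<psi> i" by blast
  have bw': "borders_wall_at \<psi> a \<mu> \<tau>\<^sub>1" "borders_wall_at \<psi> (- a) \<mu> \<tau>\<^sub>2"
    using bw unfolding \<psi>_def borders_wall_at_flip .
  then have \<tau>: "\<tau>\<^sub>1 \<in> topes \<psi>" "\<tau>\<^sub>2 \<in> topes \<psi>" "\<tau>\<^sub>1 \<subseteq> {y. 0 < a \<bullet> y}"
    unfolding borders_wall_at_def by auto
  have a\<psi>: "a \<bullet> \<psi> i = - \<bar>a \<bullet> \<phi> i\<bar>" for i by (simp add: \<psi>_def flip_def A abs_if)
  have "combination \<psi> x' = combination \<phi> x"
    unfolding combination_def by (rule sum.cong) (auto simp: x'_def \<psi>_def flip_def)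
  then have x': "combination \<psi> x' \<in> \<tau>\<^sub>2" using x by simp
  have "N' = {i. x $ i < 0} \<inter> B"
  proof (intro set_eqI)
    fix i
    have "i \<in> A \<Longrightarrow> x $ i < 0" "x $ i < 0 \<Longrightarrow> i \<notin> A \<Longrightarrow> i \<in> B" using N by blast+
    moreover have "i \<in> A \<Longrightarrow> i \<notin> B" by (simp add: A B)
    ultimately show "i \<in> N' \<longleftrightarrow> i \<in> {i. x $ i < 0} \<inter> B"
      by (cases "i \<in> A") (auto simp: N'_def x'_def)
  qed
  then have "N' \<inter> B = N'" "N' - B = {}" by auto
  \<comment> \<open>No cone of flipped vectors meets \<open>\<tau>\<^sub>1\<close>, which is on the other side of the wall.\<close>
  obtain y where y: "y \<in> \<tau>\<^sub>1" using \<tau>(1)[unfolded topes_def] in_components_nonempty by blast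
  have "I \<notin> generating_sets \<psi> \<tau>\<^sub>1" for I
    using cone_of_nonpos[of y \<psi> I a] y \<tau>(3) unfolding generating_sets_def by (force simp: a\<psi>)
  then have "alternating_sum \<psi> \<tau>\<^sub>1 N' = 0" by (simp add: alternating_sum_def)
  moreover have "alternating_sum \<psi> \<tau>\<^sub>2 N' = (if N' = {} then (- 1) ^ DIM('a) else 0)"
    unfolding N'_def by (rule alternating_sum_own_tope[OF gen' \<rho>' \<tau>(2) x'])
  moreover have "{i. a \<bullet> \<psi> i < 0} \<noteq> {}"
  proof
    assume "{i. a \<bullet> \<psi> i < 0} = {}"
    then have "range \<psi> \<subseteq> {y. a \<bullet> y = 0}" by (auto simp: a\<psi>)
    then have "span (range \<psi>) \<subseteq> {y. a \<bullet> y = 0}" using subspace_hyperplane by (rule span_minimal)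
    then have "a \<bullet> a = 0" using gen' by blast
    then show False using \<open>a \<noteq> 0\<close> by simp
  qed
  moreover have "alternating_sum \<psi> \<tau>\<^sub>1 N' - alternating_sum \<psi> \<tau>\<^sub>2 N' =
      wall_sum \<psi> B \<mu> (N' \<inter> B) * ((if N' - B = {} then (- 1) ^ card ({} :: 'n set) else 0) -
        (if N' - B = {i. a \<bullet> \<psi> i < 0} then (- 1) ^ card {i. a \<bullet> \<psi> i < 0} else 0))"
    by (rule alternating_sum_wall_crossing[OF gen' bw']) (auto simp: a\<psi> B)
  moreover have "wall_sum \<psi> B \<mu> N' = wall_sum \<phi> B \<mu> N'"
    unfolding \<psi>_def by (rule wall_sum_flip) (auto simp: A B)
  ultimately have "wall_sum \<phi> B \<mu> N' = - (if N' = {} then (- 1) ^ DIM('a) else 0)"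
    unfolding \<open>N' \<inter> B = N'\<close> \<open>N' - B = {}\<close> by auto
  then show ?thesis unfolding \<open>N' = {i. x $ i < 0} \<inter> B\<close> .
qed

section \<open>The Geometric Brianchon-Gram function on an adjacent tope\<close>

lemma brianchon_gram_adjacent_tope:
  fixes \<phi> :: "'n::finite \<Rightarrow> 'a::euclidean_space"
  assumes gen: "span (range \<phi>) = UNIV" and \<rho>: "\<And>i. 0 < \<rho> \<bullet> \<phi> i" and "a \<noteq> 0"
    and bw: "borders_wall_at \<phi> a \<mu> \<tau>\<^sub>1" "borders_wall_at \<phi> (- a) \<mu> \<tau>\<^sub>2"
    and A: "A = {i. 0 < a \<bullet> \<phi> i}" and x: "combination \<phi> x \<in> \<tau>\<^sub>2"
  shows "brianchon_gram \<phi> \<tau>\<^sub>1 x =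
    of_bool ({i. x $ i < 0} = {}) - (- 1) ^ card A * of_bool ({i. x $ i < 0} = A)"
proof -
  define N where "N = {i. x $ i < 0}"
  define B where "B = {i. a \<bullet> \<phi> i = 0}"
  define C where "C = {i. a \<bullet> \<phi> i < 0}"
  have \<tau>\<^sub>2: "\<tau>\<^sub>2 \<in> topes \<phi>" "\<tau>\<^sub>2 \<subseteq> {y. a \<bullet> y < 0}" using bw(2) unfolding borders_wall_at_def by auto
  have sign: "(- 1 :: real) ^ DIM('a) * (- 1) ^ DIM('a) = 1"
    by (simp add: power_add[symmetric] minus_one_power_iff)
  \<comment> \<open>Otherwise every term of \<open>\<Sum>i. x i (a \<bullet> \<phi> i)\<close> would be nonnegative.\<close>
  have "N - B \<noteq> C"
  proof
    assume NC: "N - B = C"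
    have "0 \<le> x $ i * (a \<bullet> \<phi> i)" for i
    proof -
      consider "a \<bullet> \<phi> i = 0" | "a \<bullet> \<phi> i < 0" | "0 < a \<bullet> \<phi> i" by linarith
      then show ?thesis
      proof cases
        case 2
        then have "x $ i < 0" using NC by (auto simp: N_def C_def)
        then show ?thesis using 2 by (simp add: mult_nonpos_nonpos)
      next
        case 3
        then have "i \<notin> B" "i \<notin> C" by (auto simp: B_def C_def)
        then have "0 \<le> x $ i" using NC by (auto simp: N_def)
        then show ?thesis using 3 by simp
      qed simp
    qed
    then have "0 \<le> a \<bullet> combination \<phi> x" unfolding inner_combination by (intro sum_nonneg) blast
    then show False using x \<tau>\<^sub>2(2) by force
  qed
  then have "alternating_sum \<phi> \<tau>\<^sub>1 N = alternating_sum \<phi> \<tau>\<^sub>2 N +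
      wall_sum \<phi> B \<mu> (N \<inter> B) * (if N - B = A then (- 1) ^ card A else 0)"
    using alternating_sum_wall_crossing[OF gen bw A B_def C_def, of N] by simp
  also have "alternating_sum \<phi> \<tau>\<^sub>2 N = (- 1) ^ DIM('a) * of_bool (N = {})"
    using alternating_sum_own_tope[of \<phi> \<rho> \<tau>\<^sub>2 x, OF gen \<rho> \<tau>\<^sub>2(1) x] unfolding N_def by simp
  also have "wall_sum \<phi> B \<mu> (N \<inter> B) * (if N - B = A then (- 1) ^ card A else 0) =
      - ((- 1) ^ DIM('a) * ((- 1) ^ card A * of_bool (N = A)))"
  proof (cases "N - B = A")
    case True
    have "A \<inter> B = {}" by (auto simp: A B_def)
    then have "N = A \<longleftrightarrow> N \<inter> B = {}" using True by blast
    then show ?thesis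
      using wall_sum_flipped_point[of \<phi> \<rho> a \<mu> \<tau>\<^sub>1 \<tau>\<^sub>2 A B x, OF gen \<rho> \<open>a \<noteq> 0\<close> bw A B_def x] True
      unfolding N_def by simp
  next
    case False
    have "N \<noteq> A" using False by (auto simp: A B_def)
    then show ?thesis using False by simp
  qed
  finally have "alternating_sum \<phi> \<tau>\<^sub>1 N =
      (- 1) ^ DIM('a) * (of_bool (N = {}) - (- 1) ^ card A * of_bool (N = A))"
    by (simp add: right_diff_distrib)
  then show ?thesis
    unfolding brianchon_gram_alternating_sum N_def using sign
    by (simp add: mult.assoc[symmetric])
qed

text \<open>Two normals of the same hyperplane are proportional.\<close>

lemma open_sides_hyperplane:
  fixes a :: "'a::euclidean_space"
  assumes "a \<noteq> 0"
  shows "open_sides {y. a \<bullet> y = 0} = {{y. 0 < a \<bullet> y}, {y. a \<bullet> y < 0}}"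
proof -
  have "{y. 0 < b \<bullet> y} = {y. 0 < a \<bullet> y} \<or> {y. 0 < b \<bullet> y} = {y. a \<bullet> y < 0}"
    if b: "b \<noteq> 0" "{y. a \<bullet> y = 0} = {y. b \<bullet> y = 0}" for b
  proof -
    \<comment> \<open>The component of \<open>b\<close> orthogonal to \<open>a\<close> lies in the hyperplane, hence vanishes.\<close>
    define t where "t = (a \<bullet> b) / (a \<bullet> a)"
    define r where "r = b - t *\<^sub>R a"
    have "a \<bullet> r = 0" using assms by (simp add: r_def t_def inner_diff_right)
    then have "b \<bullet> r = 0" using b(2) by blast
    moreover have "r \<bullet> r = b \<bullet> r - t * (a \<bullet> r)"
      unfolding r_def by (simp only: inner_diff_left inner_scaleR_left)
    ultimately have "r \<bullet> r = 0" using \<open>a \<bullet> r = 0\<close> by simp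
    then have bt: "b = t *\<^sub>R a" by (simp add: r_def)
    then have "t \<noteq> 0" using b(1) by auto
    then consider "0 < t" | "t < 0" by linarith
    then show ?thesis
      by cases (auto simp: bt zero_less_mult_iff)
  qed
  moreover have "{y. 0 < a \<bullet> y} \<in> open_sides {y. a \<bullet> y = 0}"
    unfolding open_sides_def using assms by blast
  moreover have "{y. a \<bullet> y < 0} \<in> open_sides {y. a \<bullet> y = 0}"
    unfolding open_sides_def using assms by (auto intro!: exI[of _ "- a"])
  ultimately show ?thesis unfolding open_sides_def by blast
qed

theorem theorem5:
  fixes \<phi> :: "'n::finite \<Rightarrow> 'a::euclidean_space"
    and \<tau>\<^sub>1 \<tau>\<^sub>2 H :: "'a set"
    and A :: "'n set"
    and l :: 'a
  assumes nonzero: "\<And>i. \<phi> i \<noteq> 0"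
    and generates: "span (range \<phi>) = UNIV"
    and salient: "salient (cone_of \<phi> UNIV)"
    and adjacent: "adjacent_topes \<phi> \<tau>\<^sub>1 \<tau>\<^sub>2"
    and H: "H = span (closure \<tau>\<^sub>1 \<inter> closure \<tau>\<^sub>2)"
    and A: "A = {i. \<exists>S\<in>open_sides H. \<tau>\<^sub>1 \<subseteq> S \<and> \<phi> i \<in> S}"
    and l: "l \<in> \<tau>\<^sub>2"
  shows "(\<lambda>x. brianchon_gram \<phi> \<tau>\<^sub>1 x * indicator (affine_fibre \<phi> l) x) =
         (\<lambda>x. indicator (partition_polytope \<phi> l) x
              - (- 1) ^ card A * indicator (flipped_polytope \<phi> A l) x)"
proof
  fix x :: "real ^ 'n"
  obtain \<rho> where \<rho>: "\<And>i. 0 < \<rho> \<bullet> \<phi> i"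
    using salient_positive_functional[of \<phi>, OF nonzero salient] by blast
  obtain a \<mu> where a: "H = {y. a \<bullet> y = 0}" "a \<noteq> 0"
    and bw: "borders_wall_at \<phi> a \<mu> \<tau>\<^sub>1" "borders_wall_at \<phi> (- a) \<mu> \<tau>\<^sub>2"
    using adjacent_topes_border[OF adjacent] unfolding H by blast
  have \<tau>\<^sub>1: "\<tau>\<^sub>1 \<subseteq> {y. 0 < a \<bullet> y}" "\<tau>\<^sub>1 \<noteq> {}"
    using bw(1) in_components_nonempty unfolding borders_wall_at_def topes_def by auto
  then have "\<not> \<tau>\<^sub>1 \<subseteq> {y. a \<bullet> y < 0}" by force
  then have A': "A = {i. 0 < a \<bullet> \<phi> i}"
    unfolding A a(1) open_sides_hyperplane[OF a(2)] using \<tau>\<^sub>1(1) by auto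
  show "brianchon_gram \<phi> \<tau>\<^sub>1 x * indicator (affine_fibre \<phi> l) x =
      indicator (partition_polytope \<phi> l) x - (- 1) ^ card A * indicator (flipped_polytope \<phi> A l) x"
  proof (cases "x \<in> affine_fibre \<phi> l")
    case True
    then have "combination \<phi> x \<in> \<tau>\<^sub>2" using l affine_fibre_iff by metis
    then have "brianchon_gram \<phi> \<tau>\<^sub>1 x =
        of_bool ({i. x $ i < 0} = {}) - (- 1) ^ card A * of_bool ({i. x $ i < 0} = A)"
      using brianchon_gram_adjacent_tope[of \<phi> \<rho> a \<mu> \<tau>\<^sub>1 \<tau>\<^sub>2 A x, OF generates \<rho> a(2) bw A'] by blast
    moreover have "x \<in> partition_polytope \<phi> l \<longleftrightarrow> {i. x $ i < 0} = {}"
      using True by (auto simp: partition_polytope_def not_less)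
    moreover have "x \<in> flipped_polytope \<phi> A l \<longleftrightarrow> {i. x $ i < 0} = A"
      using True by (auto simp: flipped_polytope_def not_less[symmetric])
    ultimately show ?thesis using True by (simp add: indicator_def)
  next
    case False
    then show ?thesis
      by (simp add: indicator_def partition_polytope_def flipped_polytope_def)
  qed
qed

end
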